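(* Let $X_1,\dots,X_n$ be Polish spaces, $1\le k<n$, and $\mu_\alpha\in\mathcal{P}(X_\alpha)$ for $\alpha\in\mathcal{I}_{nk}$. (a) If $c\in C_L(X,\mu_\alpha)$, then $$\inf_{\pi\in\Pi(\mu_\alpha)}\int_Xc\,d\pi=\sup\Big\{\sum_{\alpha\in\mathcal{I}_{nk}}\int_{X_\alpha}f_\alpha\,d\mu_\alpha:\ f_\alpha\in C_L(X_\alpha,\mu_\alpha),\ \sum_{\alpha\in\mathcal{I}_{nk}}f_\alpha(x_\alpha)\le c(x)\ \forall x\in X\Big\}.$$ (b) If $c\in C_b(X)$, the same equality holds with the supremum taken over $f_\alpha\in C_b(X_\alpha)$. In both cases, if $\Pi(\mu_\alpha)$ is nonempty, the infimum on the left-hand side is attained. (Convention: the infimum over the empty set is $+\infty$.)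
   Context: $X=\prod_{i=1}^nX_i$; $\mathcal{I}_{nk}$ is the family of $k$-element subsets of $\{1,\dots,n\}$; $X_\alpha=\prod_{i\in\alpha}X_i$, $x_\alpha$ is the projection of $x$ onto $X_\alpha$. $\Pi(\mu_\alpha)$ is the set of probability measures $\pi$ on $X$ whose projection onto $X_\alpha$ is $\mu_\alpha$ for every $\alpha\in\mathcal{I}_{nk}$. $C_L(X_\alpha,\mu_\alpha)=C(X_\alpha)\cap L^1(\mu_\alpha)$; $C_L(X,\mu_\alpha)$ is the set of continuous $c:X\to\mathbb{R}$ such that $|c(x)|\le\sum_{\alpha\in\mathcal{I}_{nk}}c_\alpha(x_\alpha)$ for some $c_\alpha\in C_L(X_\alpha,\mu_\alpha)$. $C_b$ denotes bounded continuous functions. *)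

theory Defs
  imports "HOL-Probability.Probability"
begin

definition Polish_space :: "'a topology \<Rightarrow> bool" where
  "Polish_space X \<longleftrightarrow> completely_metrizable_space X \<and> separable_space X"

definition borel_of :: "'a topology \<Rightarrow> 'a measure" where
  "borel_of X = sigma (topspace X) {U. openin X U}"

definition Inks :: "nat \<Rightarrow> nat \<Rightarrow> nat set set" where
  "Inks n k = {\<alpha>. \<alpha> \<subseteq> {1..n} \<and> card \<alpha> = k}"

abbreviation Xsub :: "(nat \<Rightarrow> 'a topology) \<Rightarrow> nat set \<Rightarrow> (nat \<Rightarrow> 'a) topology" where
  "Xsub X \<alpha> \<equiv> product_topology X \<alpha>"

definition Marg :: "(nat \<Rightarrow> 'a topology) \<Rightarrow> nat \<Rightarrow> nat \<Rightarrow> (nat set \<Rightarrow> (nat \<Rightarrow> 'a) measure)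
    \<Rightarrow> (nat \<Rightarrow> 'a) measure set" where
  "Marg X n k \<mu> = {\<pi>. prob_space \<pi> \<and> sets \<pi> = sets (borel_of (Xsub X {1..n})) \<and>
      (\<forall>\<alpha>\<in>Inks n k. distr \<pi> (borel_of (Xsub X \<alpha>)) (\<lambda>x. restrict x \<alpha>) = \<mu> \<alpha>)}"

definition CL :: "'b topology \<Rightarrow> 'b measure \<Rightarrow> ('b \<Rightarrow> real) set" where
  "CL Y m = {f. continuous_map Y euclideanreal f \<and> integrable m f}"

definition Cb :: "'b topology \<Rightarrow> ('b \<Rightarrow> real) set" where
  "Cb Y = {f. continuous_map Y euclideanreal f \<and> (\<exists>B. \<forall>y\<in>topspace Y. \<bar>f y\<bar> \<le> B)}"

definition CLX :: "(nat \<Rightarrow> 'a topology) \<Rightarrow> nat \<Rightarrow> nat \<Rightarrow> (nat set \<Rightarrow> (nat \<Rightarrow> 'a) measure)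
    \<Rightarrow> ((nat \<Rightarrow> 'a) \<Rightarrow> real) set" where
  "CLX X n k \<mu> = {c. continuous_map (Xsub X {1..n}) euclideanreal c \<and>
      (\<exists>cc. (\<forall>\<alpha>\<in>Inks n k. cc \<alpha> \<in> CL (Xsub X \<alpha>) (\<mu> \<alpha>)) \<and>
         (\<forall>x\<in>topspace (Xsub X {1..n}). \<bar>c x\<bar> \<le> (\<Sum>\<alpha>\<in>Inks n k. cc \<alpha> (restrict x \<alpha>))))}"

text \<open>Primal value (infimum over the empty set is +infinity) and dual value over a class F of potentials.\<close>
definition primal :: "(nat \<Rightarrow> 'a topology) \<Rightarrow> nat \<Rightarrow> nat \<Rightarrow> (nat set \<Rightarrow> (nat \<Rightarrow> 'a) measure)
    \<Rightarrow> ((nat \<Rightarrow> 'a) \<Rightarrow> real) \<Rightarrow> ereal" where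
  "primal X n k \<mu> c = (INF \<pi>\<in>Marg X n k \<mu>. ereal (\<integral>x. c x \<partial>\<pi>))"

definition dual :: "(nat \<Rightarrow> 'a topology) \<Rightarrow> nat \<Rightarrow> nat \<Rightarrow> (nat set \<Rightarrow> (nat \<Rightarrow> 'a) measure)
    \<Rightarrow> (nat set \<Rightarrow> ((nat \<Rightarrow> 'a) \<Rightarrow> real) set) \<Rightarrow> ((nat \<Rightarrow> 'a) \<Rightarrow> real) \<Rightarrow> ereal" where
  "dual X n k \<mu> F c = (SUP f\<in>{f. (\<forall>\<alpha>\<in>Inks n k. f \<alpha> \<in> F \<alpha>) \<and>
        (\<forall>x\<in>topspace (Xsub X {1..n}). (\<Sum>\<alpha>\<in>Inks n k. f \<alpha> (restrict x \<alpha>)) \<le> c x)}.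
      ereal (\<Sum>\<alpha>\<in>Inks n k. \<integral>y. f \<alpha> y \<partial>(\<mu> \<alpha>)))"

end

theory Submission
  imports Defs
begin

text \<open>The superhedging price, i.e. the infimum of the sums of integrals of potentials whose sum
  dominates c, is sublinear in c, and it is finite if the dual value is. By Hahn--Banach it
  dominates a linear functional L that touches it at the given cost. Being dominated by the price
  makes L positive and gives it the prescribed marginals. A marginal on a Polish space is tight, so a
  bounded continuous function that is small on a compact box is bounded by a small constant plus
  functions of single coordinates with small L-values; with Dini's theorem this makes L continuous
  along sequences decreasing to 0, and Daniell's construction turns it into a measure, which is an
  optimal plan. Both parts are instances of the same argument for any class of potentials between
  the bounded continuous and the integrable continuous functions that is closed under sums,
  multiples and cut-offs.\<close>

section \<open>Sublinear functionals on spaces of real functions\<close>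

text \<open>The spaces are merely Polish, so no Riesz theorem on a compact space applies directly: a
  positive functional on bounded continuous functions may be only finitely additive, and the
  prescribed marginals are what stops mass from escaping. Attainment is obtained without compactness
  of the set of plans: the functional touches the price at one given cost, so the measure
  representing it is optimal by construction. The price is an upper one, so the argument is run for
  \<open>-c\<close>, and the infimum over plans becomes minus a price. Finiteness of the price also
  decides existence: a dual value bounded above already produces a plan, while by weak duality an
  unbounded one leaves none, and then both sides are +infinity. Daniell's construction sees only
  bounded functions, whereas costs in part (a) may be unbounded. Truncation at level m leaves an
  error dominated by a sum of cut-off potentials whose integrals tend to 0; this is why cut-offs
  must stay in the class.\<close>

definition fun_subspace :: "('b \<Rightarrow> real) set \<Rightarrow> bool" where
  "fun_subspace V \<longleftrightarrow> (\<lambda>x. 0) \<in> V \<and> (\<forall>f\<in>V. \<forall>g\<in>V. (\<lambda>x. f x + g x) \<in> V)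
     \<and> (\<forall>f\<in>V. \<forall>a. (\<lambda>x. a * f x) \<in> V)"

text \<open>Homogeneity is asked only as an inequality for positive factors; applying it again with
  the factor 1/a gives the reverse inequality, so constructions have one direction to check.\<close>

definition sublinear_on :: "('b \<Rightarrow> real) set \<Rightarrow> (('b \<Rightarrow> real) \<Rightarrow> real) \<Rightarrow> bool" where
  "sublinear_on V p \<longleftrightarrow> (\<forall>f\<in>V. \<forall>g\<in>V. p (\<lambda>x. f x + g x) \<le> p f + p g)
     \<and> (\<forall>f\<in>V. \<forall>a>0. p (\<lambda>x. a * f x) \<le> a * p f)"

definition linear_fun_on :: "('b \<Rightarrow> real) set \<Rightarrow> (('b \<Rightarrow> real) \<Rightarrow> real) \<Rightarrow> bool" where
  "linear_fun_on V L \<longleftrightarrow> (\<forall>f\<in>V. \<forall>g\<in>V. L (\<lambda>x. f x + g x) = L f + L g)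
     \<and> (\<forall>f\<in>V. \<forall>a. L (\<lambda>x. a * f x) = a * L f)"

lemma fun_subspaceD:
  assumes "fun_subspace V"
  shows "(\<lambda>x. 0) \<in> V" "f \<in> V \<Longrightarrow> g \<in> V \<Longrightarrow> (\<lambda>x. f x + g x) \<in> V"
    "f \<in> V \<Longrightarrow> (\<lambda>x. a * f x) \<in> V" "f \<in> V \<Longrightarrow> (\<lambda>x. - f x) \<in> V"
    "f \<in> V \<Longrightarrow> g \<in> V \<Longrightarrow> (\<lambda>x. f x - g x) \<in> V"
proof -
  show 1: "(\<lambda>x. 0) \<in> V" "f \<in> V \<Longrightarrow> g \<in> V \<Longrightarrow> (\<lambda>x. f x + g x) \<in> V"
    "f \<in> V \<Longrightarrow> (\<lambda>x. a * f x) \<in> V" for f g a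
    using assms by (auto simp: fun_subspace_def)
  show 2: "f \<in> V \<Longrightarrow> (\<lambda>x. - f x) \<in> V" for f using 1(3)[of f "-1"] by simp
  show "f \<in> V \<Longrightarrow> g \<in> V \<Longrightarrow> (\<lambda>x. f x - g x) \<in> V" using 1(2)[OF _ 2, of f g] by simp
qed

lemma linear_fun_onD:
  assumes "linear_fun_on V L"
  shows "f \<in> V \<Longrightarrow> g \<in> V \<Longrightarrow> L (\<lambda>x. f x + g x) = L f + L g"
    "f \<in> V \<Longrightarrow> L (\<lambda>x. a * f x) = a * L f"
    "f \<in> V \<Longrightarrow> L (\<lambda>x. - f x) = - L f"
    "fun_subspace V \<Longrightarrow> f \<in> V \<Longrightarrow> g \<in> V \<Longrightarrow> L (\<lambda>x. f x - g x) = L f - L g"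
    "f \<in> V \<Longrightarrow> L (\<lambda>x. 0) = 0"
proof -
  show 1: "f \<in> V \<Longrightarrow> g \<in> V \<Longrightarrow> L (\<lambda>x. f x + g x) = L f + L g"
    "f \<in> V \<Longrightarrow> L (\<lambda>x. a * f x) = a * L f" for f g a
    using assms by (auto simp: linear_fun_on_def)
  show 2: "f \<in> V \<Longrightarrow> L (\<lambda>x. - f x) = - L f" for f using 1(2)[of f "-1"] by simp
  show "fun_subspace V \<Longrightarrow> f \<in> V \<Longrightarrow> g \<in> V \<Longrightarrow> L (\<lambda>x. f x - g x) = L f - L g"
    using 1(1)[of f "\<lambda>x. - g x"] 2[of g] fun_subspaceD(4)[of V g] by simp
  show "f \<in> V \<Longrightarrow> L (\<lambda>x. 0) = 0" using 1(2)[of f 0] by simp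
qed

lemma linear_fun_on_sum:
  assumes V: "fun_subspace V" and L: "linear_fun_on V L"
    and I: "finite I" "\<And>i. i \<in> I \<Longrightarrow> f i \<in> V"
  shows "(\<lambda>x. \<Sum>i\<in>I. f i x) \<in> V" "L (\<lambda>x. \<Sum>i\<in>I. f i x) = (\<Sum>i\<in>I. L (f i))"
proof -
  note Vs = fun_subspaceD[OF V]
  have "(\<lambda>x. \<Sum>i\<in>I. f i x) \<in> V \<and> L (\<lambda>x. \<Sum>i\<in>I. f i x) = (\<Sum>i\<in>I. L (f i))"
    using I
  proof (induction rule: finite_induct)
    case empty then show ?case using Vs(1) linear_fun_onD(5)[OF L Vs(1)] by simp
  next
    case (insert i I) then show ?case by (auto intro: Vs simp: linear_fun_onD(1)[OF L])
  qed
  then show "(\<lambda>x. \<Sum>i\<in>I. f i x) \<in> V" "L (\<lambda>x. \<Sum>i\<in>I. f i x) = (\<Sum>i\<in>I. L (f i))" by auto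
qed

lemma sublinear_onD:
  assumes V: "fun_subspace V" and q: "sublinear_on V q"
  shows "f \<in> V \<Longrightarrow> g \<in> V \<Longrightarrow> q (\<lambda>x. f x + g x) \<le> q f + q g"
    and "f \<in> V \<Longrightarrow> a > 0 \<Longrightarrow> q (\<lambda>x. a * f x) = a * q f"
    and "q (\<lambda>x. 0) = 0"
    and "f \<in> V \<Longrightarrow> - q (\<lambda>x. - f x) \<le> q f"
proof -
  show 1: "f \<in> V \<Longrightarrow> g \<in> V \<Longrightarrow> q (\<lambda>x. f x + g x) \<le> q f + q g" for f g
    using q by (auto simp: sublinear_on_def)
  have 2: "f \<in> V \<Longrightarrow> a > 0 \<Longrightarrow> q (\<lambda>x. a * f x) \<le> a * q f" for f and a :: real
    using q by (auto simp: sublinear_on_def)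
  show 3: "f \<in> V \<Longrightarrow> a > 0 \<Longrightarrow> q (\<lambda>x. a * f x) = a * q f" for f and a :: real
    using 2[of f a] 2[of "\<lambda>x. a * f x" "1/a"] fun_subspaceD(3)[OF V, of f a]
    by (simp add: field_simps)
  show 4: "q (\<lambda>x. 0) = 0" using 3[OF fun_subspaceD(1)[OF V], of 2] by simp
  show "f \<in> V \<Longrightarrow> - q (\<lambda>x. - f x) \<le> q f"
    using 1[of f "\<lambda>x. - f x"] 4 fun_subspaceD(4)[OF V, of f] by simp
qed

text \<open>The functional \<open>INF t\<ge>0. q (v + t * w) - t * q w\<close> is the largest
  sublinear one below \<open>q\<close> that is at most \<open>- q w\<close> at \<open>-w\<close>.
  Subadditivity bounds the infimum below by \<open>- q (-v)\<close>; t = 0 gives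
  \<open>r \<le> q\<close>, and t = 1 gives the value at \<open>-w\<close>.\<close>

lemma sublinear_lower:
  assumes V: "fun_subspace V" and q: "sublinear_on V q" and w: "w \<in> V"
  obtains r where "sublinear_on V r" "\<And>v. v \<in> V \<Longrightarrow> r v \<le> q v" "r (\<lambda>x. - w x) \<le> - q w"
    "\<And>v. v \<notin> V \<Longrightarrow> r v = 0"
proof -
  note Vs = fun_subspaceD[OF V] and qs = sublinear_onD[OF V q]
  define h where "h v t = q (\<lambda>x. v x + t * w x) - t * q w" for v t
  define r where "r v = (if v \<in> V then INF t\<in>{0..}. h v t else 0)" for v
  have qt: "q (\<lambda>x. t * w x) = t * q w" if "t \<ge> 0" for t
    using that qs(2)[OF w, of t] qs(3) by (cases "t = 0") auto
  have h_bd: "- q (\<lambda>x. - v x) \<le> h v t" if "v \<in> V" "t \<ge> 0" for v t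
  proof -
    have "q (\<lambda>x. t * w x) = q (\<lambda>x. (v x + t * w x) + - v x)" by simp
    also have "\<dots> \<le> q (\<lambda>x. v x + t * w x) + q (\<lambda>x. - v x)"
      by (rule qs(1)) (use that Vs w in auto)
    finally show ?thesis using qt[OF that(2)] unfolding h_def by simp
  qed
  have r_le: "r v \<le> h v t" if "v \<in> V" "t \<ge> 0" for v t
  proof -
    have "bdd_below (h v ` {0..})" by (rule bdd_belowI2[of _ "- q (\<lambda>x. - v x)"]) (use h_bd that in auto)
    then show ?thesis unfolding r_def using that by (auto intro: cINF_lower)
  qed
  have r_ge: "c \<le> r v" if "v \<in> V" "\<And>t. t \<ge> 0 \<Longrightarrow> c \<le> h v t" for v c
    unfolding r_def using that by (auto intro!: cINF_greatest)
  have sub: "r (\<lambda>x. f x + g x) \<le> r f + r g" if f: "f \<in> V" and g: "g \<in> V" for f g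
  proof -
    have *: "r (\<lambda>x. f x + g x) \<le> h f s + h g t" if s: "s \<ge> 0" and t: "t \<ge> 0" for s t
    proof -
      have 1: "r (\<lambda>x. f x + g x) \<le> h (\<lambda>x. f x + g x) (s + t)" by (rule r_le) (use f g s t Vs in auto)
      have 2: "(\<lambda>x. f x + g x + (s + t) * w x) = (\<lambda>x. (f x + s * w x) + (g x + t * w x))"
        by (simp add: algebra_simps)
      have "q (\<lambda>x. (f x + s * w x) + (g x + t * w x)) \<le> q (\<lambda>x. f x + s * w x) + q (\<lambda>x. g x + t * w x)"
        by (rule qs(1)) (use Vs f g w in auto)
      then show ?thesis using 1 unfolding h_def 2 by (simp add: distrib_right)
    qed
    have "r (\<lambda>x. f x + g x) - h g t \<le> r f" if "t \<ge> 0" for t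
      by (rule r_ge[OF f]) (use *[OF _ that] in \<open>simp add: algebra_simps\<close>)
    then have "r (\<lambda>x. f x + g x) - r f \<le> r g"
      by (intro r_ge[OF g]) (simp add: algebra_simps)
    then show ?thesis by simp
  qed
  have hom: "r (\<lambda>x. a * f x) \<le> a * r f" if f: "f \<in> V" and a: "a > 0" for f and a :: real
  proof -
    have "r (\<lambda>x. a * f x) / a \<le> r f"
    proof (rule r_ge[OF f])
      fix t :: real assume t: "t \<ge> 0"
      have "r (\<lambda>x. a * f x) \<le> h (\<lambda>x. a * f x) (a * t)" by (rule r_le) (use f a t Vs in auto)
      also have "(\<lambda>x. a * f x + a * t * w x) = (\<lambda>x. a * (f x + t * w x))" by (simp add: algebra_simps)
      then have "h (\<lambda>x. a * f x) (a * t) = a * h f t"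
        unfolding h_def using qs(2)[of "\<lambda>x. f x + t * w x" a] a f w Vs by (simp add: algebra_simps)
      finally show "r (\<lambda>x. a * f x) / a \<le> h f t" using a by (simp add: field_simps)
    qed
    then show ?thesis using a by (simp add: field_simps)
  qed
  show ?thesis
  proof (rule that[of r])
    show "sublinear_on V r" unfolding sublinear_on_def using sub hom by auto
    show "r v \<le> q v" if "v \<in> V" for v using r_le[OF that, of 0] unfolding h_def by simp
    show "r (\<lambda>x. - w x) \<le> - q w" using r_le[of "\<lambda>x. - w x" 1] w Vs qs(3) unfolding h_def by simp
    show "r v = 0" if "v \<notin> V" for v using that unfolding r_def by simp
  qed
qed

text \<open>A minimal sublinear functional below the given one exists by Zorn's lemma; it is odd because
  lowering it along any direction w leaves it unchanged, hence it is linear.\<close>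

lemma sublinear_minorant:
  assumes V: "fun_subspace V" and p: "sublinear_on V p"
  obtains L where "linear_fun_on V L" "\<And>v. v \<in> V \<Longrightarrow> L v \<le> p v"
proof -
  note Vs = fun_subspaceD[OF V]
  \<comment> \<open>Values off V are pinned to 0, so that functionals agreeing on V are equal and
    comparison on V is antisymmetric.\<close>
  define A where "A = {q. sublinear_on V q \<and> (\<forall>v\<in>V. q v \<le> p v) \<and> (\<forall>v. v \<notin> V \<longrightarrow> q v = 0)}"
  define P where "P q r \<longleftrightarrow> (\<forall>v\<in>V. r v \<le> q v)" for q r :: "_ \<Rightarrow> real"
  have "A \<noteq> {}"
  proof -
    have "(\<lambda>v. if v \<in> V then p v else 0) \<in> A"
      unfolding A_def using p Vs by (auto simp: sublinear_on_def)
    then show ?thesis by auto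
  qed
  have "\<exists>m\<in>A. \<forall>a\<in>A. P m a \<longrightarrow> a = m"
  proof (rule predicate_Zorn)
    show "partial_order_on A (relation_of P A)"
    proof (rule partial_order_on_relation_ofI)
      fix q r assume "q \<in> A" "r \<in> A" "P q r" "P r q"
      then have "q v = r v" for v by (cases "v \<in> V") (auto simp: A_def P_def intro: antisym)
      then show "q = r" by auto
    qed (auto simp: P_def intro: order_trans)
  next
    fix C assume C: "C \<in> Chains (relation_of P A)"
    have CA: "C \<subseteq> A" and Ct: "\<And>q r. q \<in> C \<Longrightarrow> r \<in> C \<Longrightarrow> P q r \<or> P r q"
      using C by (auto simp: Chains_def relation_of_def)
    show "\<exists>u\<in>A. \<forall>a\<in>C. P a u"
    proof (cases "C = {}")
      case True then show ?thesis using \<open>A \<noteq> {}\<close> by auto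
    next
      case False
      define u where "u v = (if v \<in> V then INF q\<in>C. q v else 0)" for v
      \<comment> \<open>Every member lies above \<open>v \<mapsto> - p (-v)\<close>, so the
        pointwise infimum of a chain is finite.\<close>
      have lb: "- p (\<lambda>x. - v x) \<le> q v" if "q \<in> C" "v \<in> V" for q v
      proof -
        have q: "sublinear_on V q" "\<forall>v\<in>V. q v \<le> p v" using that CA by (auto simp: A_def)
        show ?thesis using sublinear_onD(4)[OF V q(1) that(2)] q(2)[rule_format, OF Vs(4)[OF that(2)]] by simp
      qed
      have u_le: "u v \<le> q v" if "q \<in> C" "v \<in> V" for q v
        unfolding u_def using that lb by (auto intro!: cINF_lower bdd_belowI2[of _ "- p (\<lambda>x. - v x)"])
      have u_ge: "c \<le> u v" if "v \<in> V" "\<And>q. q \<in> C \<Longrightarrow> c \<le> q v" for v c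
        unfolding u_def using that False by (auto intro!: cINF_greatest)
      have sub: "u (\<lambda>x. f x + g x) \<le> u f + u g" if f: "f \<in> V" and g: "g \<in> V" for f g
      proof -
        have *: "u (\<lambda>x. f x + g x) \<le> q f + r g" if q: "q \<in> C" and r: "r \<in> C" for q r
        proof -
          \<comment> \<open>An infimum of sublinear functionals is not subadditive in general; in a
            chain the smaller of \<open>q\<close> and \<open>r\<close> serves both arguments at
            once.\<close>
          obtain s where s: "s \<in> C" "s f \<le> q f" "s g \<le> r g"
            using Ct[OF q r] q r f g by (auto simp: P_def)
          have "u (\<lambda>x. f x + g x) \<le> s (\<lambda>x. f x + g x)" by (rule u_le) (use s f g Vs in auto)
          also have "\<dots> \<le> s f + s g" using sublinear_onD(1)[OF V _ f g, of s] s CA by (auto simp: A_def)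
          finally show ?thesis using s by simp
        qed
        have "u (\<lambda>x. f x + g x) - r g \<le> u f" if "r \<in> C" for r
          by (rule u_ge[OF f]) (use *[OF _ that] in \<open>simp add: algebra_simps\<close>)
        then have "u (\<lambda>x. f x + g x) - u f \<le> u g"
          by (intro u_ge[OF g]) (simp add: algebra_simps)
        then show ?thesis by simp
      qed
      have hom: "u (\<lambda>x. a * f x) \<le> a * u f" if f: "f \<in> V" and a: "a > 0" for f and a :: real
      proof -
        have "u (\<lambda>x. a * f x) / a \<le> u f"
        proof (rule u_ge[OF f])
          fix q assume q: "q \<in> C"
          have "u (\<lambda>x. a * f x) \<le> q (\<lambda>x. a * f x)" by (rule u_le) (use f q Vs in auto)
          also have "\<dots> = a * q f" using sublinear_onD(2)[OF V _ f a, of q] q CA by (auto simp: A_def)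
          finally show "u (\<lambda>x. a * f x) / a \<le> q f" using a by (simp add: field_simps)
        qed
        then show ?thesis using a by (simp add: field_simps)
      qed
      obtain q0 where q0: "q0 \<in> C" using False by auto
      have "u \<in> A" unfolding A_def sublinear_on_def
      proof (intro CollectI conjI ballI allI impI)
        fix v assume v: "v \<in> V"
        show "u v \<le> p v" using u_le[OF q0 v] q0 CA v by (auto simp: A_def intro: order_trans)
      qed (use sub hom in \<open>auto simp: u_def\<close>)
      then show ?thesis using u_le by (auto simp: P_def)
    qed
  qed
  then obtain m where m: "m \<in> A" and min: "\<And>a. a \<in> A \<Longrightarrow> P m a \<Longrightarrow> a = m" by auto
  have sm: "sublinear_on V m" and mp: "\<And>v. v \<in> V \<Longrightarrow> m v \<le> p v" using m by (auto simp: A_def)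
  note ms = sublinear_onD[OF V sm]
  have odd: "m (\<lambda>x. - w x) = - m w" if w: "w \<in> V" for w
  proof -
    obtain r where r: "sublinear_on V r" "\<And>v. v \<in> V \<Longrightarrow> r v \<le> m v" "r (\<lambda>x. - w x) \<le> - m w"
        "\<And>v. v \<notin> V \<Longrightarrow> r v = 0"
      using sublinear_lower[OF V sm w] by blast
    have "r \<in> A" using r mp by (auto simp: A_def intro: order_trans)
    then have "r = m" using min r(2) by (auto simp: P_def)
    then show ?thesis using r(3) ms(4)[OF w] by simp
  qed
  have "linear_fun_on V m" unfolding linear_fun_on_def
  proof (intro conjI ballI allI)
    fix f g assume f: "f \<in> V" and g: "g \<in> V"
    have "m (\<lambda>x. - f x + - g x) \<le> - m f + - m g" using ms(1)[of "\<lambda>x. - f x" "\<lambda>x. - g x"] f g Vs odd by auto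
    moreover have "m (\<lambda>x. - f x + - g x) = - m (\<lambda>x. f x + g x)"
      using odd[of "\<lambda>x. f x + g x"] Vs f g by simp
    ultimately show "m (\<lambda>x. f x + g x) = m f + m g" using ms(1)[OF f g] by simp
  next
    fix f and a :: real assume f: "f \<in> V"
    consider "a > 0" | "a = 0" | "a < 0" by linarith
    then show "m (\<lambda>x. a * f x) = a * m f"
    proof cases
      case 3
      then have "m (\<lambda>x. (-a) * f x) = - a * m f" using ms(2)[OF f, of "-a"] by simp
      then show ?thesis using odd[of "\<lambda>x. a * f x"] f Vs by simp
    qed (use ms f in auto)
  qed
  then show ?thesis using mp that by blast
qed

text \<open>Lowering \<open>p\<close> along w before taking a linear minorant forces
  \<open>L (-w) \<le> - p w\<close>, which by linearity is the missing inequality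
  \<open>p w \<le> L w\<close>. This replaces extension from the line spanned by w.\<close>

lemma Hahn_Banach_attained:
  assumes V: "fun_subspace V" and p: "sublinear_on V p" and w: "w \<in> V"
  obtains L where "linear_fun_on V L" "\<And>v. v \<in> V \<Longrightarrow> L v \<le> p v" "L w = p w"
proof -
  obtain r where r: "sublinear_on V r" "\<And>v. v \<in> V \<Longrightarrow> r v \<le> p v" "r (\<lambda>x. - w x) \<le> - p w"
    using sublinear_lower[OF V p w] by metis
  obtain L where L: "linear_fun_on V L" "\<And>v. v \<in> V \<Longrightarrow> L v \<le> r v"
    using sublinear_minorant[OF V r(1)] by blast
  have "- L w \<le> - p w"
    using L(2)[OF fun_subspaceD(4)[OF V w]] r(3) linear_fun_onD(3)[OF L(1) w] by simp
  then have "L w = p w" using L(2)[OF w] r(2)[OF w] by simp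
  then show ?thesis using that L r(2) order_trans by blast
qed

section \<open>Borel measures and bounded continuous functions\<close>

lemma space_borel_of [simp]: "space (borel_of Y) = topspace Y"
  unfolding borel_of_def by (subst space_measure_of) (auto dest: openin_subset)

lemma sets_borel_of: "sets (borel_of Y) = sigma_sets (topspace Y) {U. openin Y U}"
  unfolding borel_of_def by (subst sets_measure_of) (auto dest: openin_subset)

lemma openin_borel_of: "openin Y U \<Longrightarrow> U \<in> sets (borel_of Y)"
  unfolding sets_borel_of by auto

lemma closedin_borel_of:
  assumes "closedin Y C" shows "C \<in> sets (borel_of Y)"
proof -
  have "topspace Y - (topspace Y - C) \<in> sets (borel_of Y)"
    unfolding space_borel_of[symmetric]
    by (rule sets.compl_sets, rule openin_borel_of) (use assms in auto)
  then show ?thesis using closedin_subset[OF assms] by (simp add: double_diff)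
qed

lemma continuous_map_measurable_borel_of:
  assumes "continuous_map Y Z f" shows "f \<in> borel_of Y \<rightarrow>\<^sub>M borel_of Z"
  unfolding borel_of_def[of Z]
proof (rule measurable_measure_of)
  show "{U. openin Z U} \<subseteq> Pow (topspace Z)" by (auto dest: openin_subset)
  show "f \<in> space (borel_of Y) \<rightarrow> topspace Z" using assms by (auto simp: continuous_map_def)
  show "f -` U \<inter> space (borel_of Y) \<in> sets (borel_of Y)" if "U \<in> {U. openin Z U}" for U
  proof -
    have "f -` U \<inter> space (borel_of Y) = {x \<in> topspace Y. f x \<in> U}" by auto
    then show ?thesis using openin_continuous_map_preimage[OF assms, of U] that
      by (auto intro: openin_borel_of)
  qed
qed

lemma continuous_map_borel_measurable:
  fixes f :: "'b \<Rightarrow> real"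
  assumes "continuous_map Y euclideanreal f" "sets M = sets (borel_of Y)"
  shows "f \<in> borel_measurable M"
proof -
  have "f \<in> borel_of Y \<rightarrow>\<^sub>M borel_of euclideanreal"
    by (rule continuous_map_measurable_borel_of[OF assms(1)])
  moreover have "sets (borel_of euclideanreal) = sets borel"
    unfolding borel_of_def borel_def by simp
  ultimately show ?thesis using assms(2) by (simp cong: measurable_cong_sets)
qed

lemma space_eq_topspace: "sets M = sets (borel_of Y) \<Longrightarrow> space M = topspace Y"
  using sets_eq_imp_space_eq[of M "borel_of Y"] by simp

lemma integrable_Cb:
  assumes "finite_measure M" "sets M = sets (borel_of Y)" "f \<in> Cb Y"
  shows "integrable M f"
proof -
  obtain B where B: "\<And>y. y \<in> topspace Y \<Longrightarrow> \<bar>f y\<bar> \<le> B" using assms(3) by (auto simp: Cb_def)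
  show ?thesis
    by (rule finite_measure.integrable_const_bound[OF assms(1), of _ B])
      (use B assms in \<open>auto simp: Cb_def space_eq_topspace intro: continuous_map_borel_measurable\<close>)
qed

lemma CbI: "continuous_map Y euclideanreal f \<Longrightarrow> (\<And>y. y \<in> topspace Y \<Longrightarrow> \<bar>f y\<bar> \<le> B) \<Longrightarrow> f \<in> Cb Y"
  by (auto simp: Cb_def)

lemma Cb_const: "(\<lambda>x. a) \<in> Cb Y" by (rule CbI[of _ _ "\<bar>a\<bar>"]) auto

lemma Cb_cont: "f \<in> Cb Y \<Longrightarrow> continuous_map Y euclideanreal f"
  by (auto simp: Cb_def)

lemma Cb_add:
  assumes "f \<in> Cb Y" "g \<in> Cb Y" shows "(\<lambda>x. f x + g x) \<in> Cb Y"
proof -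
  from assms obtain B C where "\<And>y. y \<in> topspace Y \<Longrightarrow> \<bar>f y\<bar> \<le> B" "\<And>y. y \<in> topspace Y \<Longrightarrow> \<bar>g y\<bar> \<le> C"
    by (auto simp: Cb_def)
  then show ?thesis using assms Cb_cont
    by (intro CbI[of _ _ "B + C"] continuous_map_add)
       (auto intro: order_trans[OF abs_triangle_ineq] add_mono)
qed

lemma Cb_mult:
  assumes "f \<in> Cb Y" "g \<in> Cb Y" shows "(\<lambda>x. f x * g x) \<in> Cb Y"
proof -
  from assms obtain B C where BC: "\<And>y. y \<in> topspace Y \<Longrightarrow> \<bar>f y\<bar> \<le> B" "\<And>y. y \<in> topspace Y \<Longrightarrow> \<bar>g y\<bar> \<le> C"
    by (auto simp: Cb_def)
  show ?thesis using assms Cb_cont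
  proof (intro CbI[of _ _ "B * C"] continuous_map_real_mult)
    fix y assume "y \<in> topspace Y"
    then show "\<bar>f y * g y\<bar> \<le> B * C" unfolding abs_mult using BC[of y] by (intro mult_mono) auto
  qed auto
qed

lemma Cb_max:
  assumes "f \<in> Cb Y" "g \<in> Cb Y" shows "(\<lambda>x. max (f x) (g x)) \<in> Cb Y"
proof -
  from assms obtain B C where BC: "\<And>y. y \<in> topspace Y \<Longrightarrow> \<bar>f y\<bar> \<le> B" "\<And>y. y \<in> topspace Y \<Longrightarrow> \<bar>g y\<bar> \<le> C"
    by (auto simp: Cb_def)
  show ?thesis using assms Cb_cont
  proof (intro CbI[of _ _ "max B C"] continuous_map_real_max)
    fix y assume "y \<in> topspace Y"
    then show "\<bar>max (f y) (g y)\<bar> \<le> max B C" using BC[of y] by (auto simp: max_def)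
  qed auto
qed

lemma Cb_subspace: "fun_subspace (Cb Y)"
  unfolding fun_subspace_def by (auto intro: Cb_const Cb_add Cb_mult)

lemma Cb_diff: "f \<in> Cb Y \<Longrightarrow> g \<in> Cb Y \<Longrightarrow> (\<lambda>x. f x - g x) \<in> Cb Y"
  by (rule fun_subspaceD(5)[OF Cb_subspace])

lemma Cb_min:
  assumes "f \<in> Cb Y" "g \<in> Cb Y" shows "(\<lambda>x. min (f x) (g x)) \<in> Cb Y"
proof -
  have "(\<lambda>x. - max (- f x) (- g x)) \<in> Cb Y"
    by (intro fun_subspaceD(4)[OF Cb_subspace] Cb_max assms)
  moreover have "(\<lambda>x. - max (- f x) (- g x)) = (\<lambda>x. min (f x) (g x))" by (auto simp: fun_eq_iff)
  ultimately show ?thesis by simp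
qed

section \<open>Distance functions and open sets of metrizable spaces\<close>

context Metric_space
begin

lemma bdd_below_dist: "bdd_below (d u ` A)"
  by (meson bdd_belowI2 nonneg)

lemma continuous_map_INF_dist:
  assumes A: "A \<subseteq> M" "A \<noteq> {}"
  shows "continuous_map mtopology euclideanreal (\<lambda>x. INF a\<in>A. d x a)"
proof -
  have le: "(INF a\<in>A. d x a) - (INF a\<in>A. d y a) \<le> d x y" if "x \<in> M" "y \<in> M" for x y
  proof -
    have "(INF a\<in>A. d x a) - d x y \<le> (INF a\<in>A. d y a)"
    proof (rule cINF_greatest[OF A(2)])
      fix a assume a: "a \<in> A"
      have "(INF a\<in>A. d x a) \<le> d x a" by (rule cINF_lower[OF bdd_below_dist a])
      also have "\<dots> \<le> d x y + d y a" using triangle that a A by auto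
      finally show "(INF a\<in>A. d x a) - d x y \<le> d y a" by simp
    qed
    then show ?thesis by simp
  qed
  show ?thesis
    unfolding continuous_map_from_metric
  proof (intro conjI ballI allI impI)
    fix x U assume x: "x \<in> M" and U: "openin euclideanreal U \<and> (INF a\<in>A. d x a) \<in> U"
    then obtain e where e: "e > 0" "\<And>z. dist z (INF a\<in>A. d x a) < e \<Longrightarrow> z \<in> U"
      by (auto simp: open_dist)
    show "\<exists>r>0. \<forall>y. y \<in> M \<and> d x y < r \<longrightarrow> (INF a\<in>A. d y a) \<in> U"
    proof (intro exI[of _ e] conjI allI impI)
      fix y assume y: "y \<in> M \<and> d x y < e"
      show "(INF a\<in>A. d y a) \<in> U"
        by (rule e(2)) (use le[of x y] le[of y x] x y commute in \<open>auto simp: dist_real_def\<close>)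
    qed (use e in auto)
  qed auto
qed

end

text \<open>The distance to the complement of U, capped at 1, is positive exactly on U because U is
  open. Its multiples capped at 1 increase to the indicator of U, which is how open sets are reached
  from continuous functions later on.\<close>

lemma metrizable_cozero:
  assumes Y: "metrizable_space Y" and U: "openin Y U"
  obtains g where "continuous_map Y euclideanreal g" "\<And>x. x \<in> topspace Y \<Longrightarrow> 0 \<le> g x \<and> g x \<le> 1"
    "U = {x \<in> topspace Y. g x > 0}"
proof (cases "topspace Y - U = {}")
  \<comment> \<open>With an empty complement there is no distance to take an infimum of; the
    constant 1 serves.\<close>
  case True
  then have "U = topspace Y" using openin_subset[OF U] by auto
  then show ?thesis by (intro that[of "\<lambda>x. 1"]) simp_all
next
  case False
  obtain M d where "Metric_space M d" and Yd: "Y = Metric_space.mtopology M d"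
    using Y by (auto simp: metrizable_space_def)
  interpret Metric_space M d by fact
  have M: "topspace Y = M" using Yd by simp
  define h where "h x = (INF a\<in>M - U. d x a)" for x
  have ne: "M - U \<noteq> {}" using False M by simp
  have h0: "h x \<ge> 0" for x unfolding h_def by (rule cINF_greatest[OF ne]) simp
  have hc: "continuous_map Y euclideanreal h" unfolding Yd h_def
    by (rule continuous_map_INF_dist) (use ne in auto)
  have hU: "h x > 0 \<longleftrightarrow> x \<in> U" if x: "x \<in> M" for x
  proof
    assume "x \<in> U"
    then obtain r where r: "r > 0" "mball x r \<subseteq> U" using U Yd by (auto simp: openin_mtopology)
    have "r \<le> h x" unfolding h_def
    proof (rule cINF_greatest[OF ne])
      fix a assume "a \<in> M - U"
      then have "a \<notin> mball x r" "a \<in> M" using r by auto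
      then show "r \<le> d x a" using x by (simp add: in_mball)
    qed
    then show "h x > 0" using r by simp
  next
    assume h: "h x > 0"
    show "x \<in> U"
    proof (rule ccontr)
      assume "x \<notin> U"
      then have "h x \<le> d x x" unfolding h_def by (intro cINF_lower[OF bdd_below_dist]) (use x in auto)
      then show False using h x by simp
    qed
  qed
  show ?thesis
  proof (rule that[of "\<lambda>x. min 1 (h x)"])
    show "continuous_map Y euclideanreal (\<lambda>x. min 1 (h x))"
      by (intro continuous_map_real_min hc) auto
    show "U = {x \<in> topspace Y. 0 < min 1 (h x)}"
      using hU M openin_subset[OF U] by auto
  qed (use h0 in auto)
qed

text \<open>Open sets form an intersection-stable generator, and dominated convergence along
  \<open>min 1 (j * g)\<close> turns equal integrals into equal measures of open sets. This is what
  identifies the marginals of the Daniell measure.\<close>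

lemma finite_borel_measure_eqI:
  assumes Y: "metrizable_space Y"
    and M: "finite_measure M" "sets M = sets (borel_of Y)"
    and N: "finite_measure N" "sets N = sets (borel_of Y)"
    and eq: "\<And>f. f \<in> Cb Y \<Longrightarrow> (\<integral>x. f x \<partial>M) = (\<integral>x. f x \<partial>N)"
  shows "M = N"
proof (rule measure_eqI_generator_eq[where E="{U. openin Y U}" and \<Omega>="topspace Y" and A="\<lambda>_. topspace Y"])
  show "Int_stable {U. openin Y U}" by (auto simp: Int_stable_def)
  show "{U. openin Y U} \<subseteq> Pow (topspace Y)" by (auto dest: openin_subset)
  show "sets M = sigma_sets (topspace Y) {U. openin Y U}" "sets N = sigma_sets (topspace Y) {U. openin Y U}"
    using M N sets_borel_of by auto
  show "emeasure M (topspace Y) \<noteq> \<infinity>" using M(1) by (simp add: finite_measure.emeasure_finite)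
  fix U assume "U \<in> {U. openin Y U}"
  then have U: "openin Y U" by simp
  obtain g where g: "continuous_map Y euclideanreal g" "\<And>x. x \<in> topspace Y \<Longrightarrow> 0 \<le> g x \<and> g x \<le> 1"
    "U = {x \<in> topspace Y. g x > 0}" using metrizable_cozero[OF Y U] by blast
  define h where "h j x = min 1 (real j * g x)" for j x
  have hc: "continuous_map Y euclideanreal (h j)" for j unfolding h_def
    by (intro continuous_map_real_min continuous_map_real_mult g(1)) auto
  have h01: "0 \<le> h j x" "h j x \<le> 1" if "x \<in> topspace Y" for j x using g(2)[OF that] by (auto simp: h_def)
  have hlim: "(\<lambda>j. h j x) \<longlonglongrightarrow> indicator U x" if x: "x \<in> topspace Y" for x
  proof (cases "x \<in> U")
    case True
    then have gx: "g x > 0" using g(3) by auto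
    obtain J where J: "real J * g x > 1" using reals_Archimedean3[OF gx] by blast
    have "\<forall>\<^sub>F j in sequentially. h j x = 1"
    proof (rule eventually_sequentiallyI[of J])
      fix j assume "j \<ge> J"
      then have "real J * g x \<le> real j * g x" using gx by (intro mult_right_mono) auto
      then show "h j x = 1" using J by (simp add: h_def)
    qed
    then show ?thesis using True by (simp add: tendsto_eventually)
  next
    case False
    then have "g x = 0" using g(2)[OF x] g(3) x by auto
    then show ?thesis using False by (simp add: h_def)
  qed
  have lim: "(\<lambda>j. \<integral>x. h j x \<partial>K) \<longlonglongrightarrow> measure K U"
    if K: "finite_measure K" "sets K = sets (borel_of Y)" for K
  proof -
    interpret finite_measure K by fact
    have "(\<lambda>j. \<integral>x. h j x \<partial>K) \<longlonglongrightarrow> (\<integral>x. indicator U x \<partial>K)"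
    proof (rule integral_dominated_convergence[where w="\<lambda>_. 1"])
      show "(indicator U :: _ \<Rightarrow> real) \<in> borel_measurable K" using openin_borel_of[OF U] K by simp
      show "h j \<in> borel_measurable K" for j using continuous_map_borel_measurable[OF hc K(2)] .
    qed (use h01 hlim space_eq_topspace[OF K(2)] in auto)
    moreover have "(\<integral>x. indicator U x \<partial>K) = measure K U"
      using openin_borel_of[OF U] K by simp
    ultimately show ?thesis by simp
  qed
  have "h j \<in> Cb Y" for j by (rule CbI[OF hc, where B=1]) (use h01 in auto)
  then have "measure M U = measure N U"
    using LIMSEQ_unique[OF lim[OF M]] lim[OF N] eq by simp
  then show "emeasure M U = emeasure N U"
    using M(1) N(1) by (simp add: finite_measure.emeasure_eq_measure)
qed auto

section \<open>The Daniell representation of functionals on bounded continuous functions\<close>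

text \<open>Such a sequence stands for its supremum, a lower semicontinuous function above the
  indicator of A. Keeping the sequence avoids infinite values and leaves every term in the domain of
  L.\<close>

definition majorants :: "'b topology \<Rightarrow> 'b set \<Rightarrow> (nat \<Rightarrow> 'b \<Rightarrow> real) set" where
  "majorants Y A = {F. (\<forall>j. F j \<in> Cb Y) \<and> (\<forall>j. \<forall>x\<in>topspace Y. 0 \<le> F j x \<and> F j x \<le> F (Suc j) x)
      \<and> (\<forall>x\<in>A. \<exists>j. 1 \<le> F j x)}"

text \<open>This is the Daniell upper integral of the indicator of A. For monotone L the supremum
  over j is a limit.\<close>

definition Daniell_outer :: "'b topology \<Rightarrow> (('b \<Rightarrow> real) \<Rightarrow> real) \<Rightarrow> 'b set \<Rightarrow> ennreal" where
  "Daniell_outer Y L A = (INF F\<in>majorants Y A. SUP j. ennreal (L (F j)))"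

locale Daniell_functional =
  fixes Y :: "'b topology" and L :: "('b \<Rightarrow> real) \<Rightarrow> real"
  assumes metrizable: "metrizable_space Y"
    and linear: "linear_fun_on (Cb Y) L"
    and mono: "\<And>f g. f \<in> Cb Y \<Longrightarrow> g \<in> Cb Y \<Longrightarrow> (\<And>x. x \<in> topspace Y \<Longrightarrow> f x \<le> g x) \<Longrightarrow> L f \<le> L g"
    and cont: "\<And>f. (\<And>j. f j \<in> Cb Y) \<Longrightarrow> (\<And>j x. x \<in> topspace Y \<Longrightarrow> 0 \<le> f j x) \<Longrightarrow>
       (\<And>j x. x \<in> topspace Y \<Longrightarrow> f (Suc j) x \<le> f j x) \<Longrightarrow>
       (\<And>x. x \<in> topspace Y \<Longrightarrow> (\<lambda>j. f j x) \<longlonglongrightarrow> 0) \<Longrightarrow> (\<lambda>j. L (f j)) \<longlonglongrightarrow> 0"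
begin

lemmas L_linear = linear_fun_onD[OF linear]
lemmas L_sum = linear_fun_on_sum[OF Cb_subspace linear]

abbreviation \<mu> :: "'b set \<Rightarrow> ennreal" where "\<mu> \<equiv> Daniell_outer Y L"

lemma L_nonneg: "f \<in> Cb Y \<Longrightarrow> (\<And>x. x \<in> topspace Y \<Longrightarrow> 0 \<le> f x) \<Longrightarrow> 0 \<le> L f"
  using mono[of "\<lambda>x. 0" f] L_linear(5)[of f] Cb_const by auto

lemma majorantsD:
  assumes "F \<in> majorants Y A"
  shows "F j \<in> Cb Y" "x \<in> topspace Y \<Longrightarrow> 0 \<le> F j x" "x \<in> topspace Y \<Longrightarrow> i \<le> j \<Longrightarrow> F i x \<le> F j x"
    "x \<in> A \<Longrightarrow> \<exists>j. 1 \<le> F j x"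
proof -
  show "F j \<in> Cb Y" "x \<in> topspace Y \<Longrightarrow> 0 \<le> F j x" "x \<in> A \<Longrightarrow> \<exists>j. 1 \<le> F j x" for j
    using assms by (auto simp: majorants_def)
  show "F i x \<le> F j x" if "x \<in> topspace Y" "i \<le> j"
    using that(2) by (rule lift_Suc_mono_le[rotated]) (use assms that(1) in \<open>auto simp: majorants_def\<close>)
qed

lemma outer_le: "F \<in> majorants Y A \<Longrightarrow> \<mu> A \<le> (SUP j. ennreal (L (F j)))"
  unfolding Daniell_outer_def by (rule INF_lower)

lemma outer_le_L:
  assumes "f \<in> Cb Y" "\<And>x. x \<in> topspace Y \<Longrightarrow> 0 \<le> f x" "\<And>x. x \<in> A \<Longrightarrow> 1 \<le> f x"
  shows "\<mu> A \<le> ennreal (L f)"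
proof -
  have "\<mu> A \<le> (SUP j::nat. ennreal (L f))"
    by (rule outer_le[of "\<lambda>_. f"]) (use assms in \<open>auto simp: majorants_def\<close>)
  then show ?thesis by simp
qed

lemma outer_empty: "\<mu> {} = 0"
  using outer_le_L[of "\<lambda>x. 0" "{}"] Cb_const L_linear(5)[OF Cb_const] by auto

lemma outer_mono: "A \<subseteq> B \<Longrightarrow> \<mu> A \<le> \<mu> B"
  unfolding Daniell_outer_def by (rule INF_superset_mono) (auto simp: majorants_def)

lemma outer_UN_le:
  fixes A :: "nat \<Rightarrow> 'b set"
  assumes A: "\<And>i. A i \<subseteq> topspace Y"
  shows "\<mu> (\<Union>i. A i) \<le> (\<Sum>i. \<mu> (A i))"
proof (rule ennreal_le_epsilon)
  fix e :: real assume fin: "(\<Sum>i. \<mu> (A i)) < top" and e: "0 < e"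
  have "\<exists>F\<in>majorants Y (A i). (SUP j. ennreal (L (F j))) \<le> \<mu> (A i) + ennreal (e * (1/2) ^ Suc i)" for i
  proof -
    have "\<mu> (A i) < top" using fin ennreal_suminf_lessD by blast
    then have "\<mu> (A i) < \<mu> (A i) + ennreal (e * (1/2) ^ Suc i)"
      using e by (simp add: ennreal_zero_less_mult_iff)
    then obtain F where "F \<in> majorants Y (A i)" "(SUP j. ennreal (L (F j))) < \<mu> (A i) + ennreal (e * (1/2) ^ Suc i)"
      unfolding Daniell_outer_def INF_less_iff by auto
    then show ?thesis by (auto intro: less_imp_le)
  qed
  then obtain F where F: "\<And>i. F i \<in> majorants Y (A i)"
    and FL: "\<And>i. (SUP j. ennreal (L (F i j))) \<le> \<mu> (A i) + ennreal (e * (1/2) ^ Suc i)"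
    by metis
  note Fs = majorantsD[OF F]
  \<comment> \<open>The diagonal sum adds one more majorant at each stage while the earlier ones
    advance, so a countable family of increasing sequences becomes a single increasing sequence in
    \<open>Cb Y\<close>.\<close>
  define G where "G j x = (\<Sum>i<j. F i j x)" for j x
  have G: "G j \<in> Cb Y" "L (G j) = (\<Sum>i<j. L (F i j))" for j
    using L_sum[of "{..<j}" "\<lambda>i. F i j"] Fs(1) unfolding G_def by auto
  have Gm: "G \<in> majorants Y (\<Union>i. A i)"
    unfolding majorants_def
  proof (intro CollectI conjI allI ballI)
    fix j x assume x: "x \<in> topspace Y"
    show "0 \<le> G j x" unfolding G_def by (rule sum_nonneg) (use Fs(2) x in auto)
    have "G j x \<le> (\<Sum>i<j. F i (Suc j) x)" unfolding G_def by (rule sum_mono) (use Fs(3) x in auto)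
    also have "\<dots> \<le> G (Suc j) x" unfolding G_def using Fs(2)[OF x] by simp
    finally show "G j x \<le> G (Suc j) x" .
  next
    fix x assume "x \<in> (\<Union>i. A i)"
    then obtain i where i: "x \<in> A i" by auto
    then have x: "x \<in> topspace Y" using A by auto
    obtain j where j: "1 \<le> F i j x" using Fs(4)[OF i] by auto
    \<comment> \<open>\<open>Suc i\<close> brings the i-th majorant into the range
      \<open>i < k\<close> of the diagonal sum, and j makes it reach 1.\<close>
    define k where "k = max j (Suc i)"
    have "1 \<le> F i k x" using j Fs(3)[OF x, of j k i] unfolding k_def by simp
    also have "\<dots> \<le> G k x" unfolding G_def
      by (rule member_le_sum) (use Fs(2) x in \<open>auto simp: k_def\<close>)
    finally show "\<exists>j. 1 \<le> G j x" by auto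
  qed (rule G)
  have "\<mu> (\<Union>i. A i) \<le> (SUP j. ennreal (L (G j)))" by (rule outer_le[OF Gm])
  also have "\<dots> \<le> (\<Sum>i. \<mu> (A i) + ennreal (e * (1/2) ^ Suc i))"
  proof (rule SUP_least)
    fix j
    have "ennreal (L (G j)) = (\<Sum>i<j. ennreal (L (F i j)))"
      unfolding G by (rule sum_ennreal[symmetric]) (auto intro!: L_nonneg Fs)
    also have "\<dots> \<le> (\<Sum>i<j. \<mu> (A i) + ennreal (e * (1/2) ^ Suc i))"
      by (rule sum_mono) (rule order_trans[OF _ FL], rule SUP_upper, simp)
    also have "\<dots> \<le> (\<Sum>i. \<mu> (A i) + ennreal (e * (1/2) ^ Suc i))"
      by (rule sum_le_suminf) auto
    finally show "ennreal (L (G j)) \<le> (\<Sum>i. \<mu> (A i) + ennreal (e * (1/2) ^ Suc i))" .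
  qed
  also have "\<dots> = (\<Sum>i. \<mu> (A i)) + (\<Sum>i. ennreal (e * (1/2) ^ Suc i))"
    by (rule suminf_add[symmetric]) auto
  also have "(\<Sum>i. ennreal (e * (1/2) ^ Suc i)) = ennreal e"
    by (rule suminf_ennreal_eq) (use e sums_mult[OF power_half_series, of e] in auto)
  finally show "\<mu> (\<Union>i. A i) \<le> (\<Sum>i. \<mu> (A i)) + ennreal e" .
qed

lemma outer_measure_space_outer: "outer_measure_space (Pow (topspace Y)) \<mu>"
  unfolding outer_measure_space_def positive_def increasing_def countably_subadditive_def
  using outer_empty outer_mono outer_UN_le by (auto simp: image_subset_iff)

text \<open>A majorant of E is split by the cut-offs min 1 (j * g), which increase to the indicator of U.\<close>

lemma outer_split:
  assumes U: "openin Y U" and E: "E \<subseteq> topspace Y"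
  shows "\<mu> (E \<inter> U) + \<mu> (E - U) \<le> \<mu> E"
proof -
  obtain g where g: "continuous_map Y euclideanreal g" "\<And>x. x \<in> topspace Y \<Longrightarrow> 0 \<le> g x \<and> g x \<le> 1"
    "U = {x \<in> topspace Y. g x > 0}" using metrizable_cozero[OF metrizable U] by blast
  define h where "h j x = min 1 (real j * g x)" for j x
  have hc: "continuous_map Y euclideanreal (h j)" for j unfolding h_def
    by (intro continuous_map_real_min continuous_map_real_mult g(1)) auto
  have h01: "0 \<le> h j x" "h j x \<le> 1" if "x \<in> topspace Y" for j x using g(2)[OF that] by (auto simp: h_def)
  have hCb: "h j \<in> Cb Y" for j by (rule CbI[OF hc, where B=1]) (use h01 in auto)
  have hmono: "h i x \<le> h j x" if "x \<in> topspace Y" "i \<le> j" for i j x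
    unfolding h_def using g(2)[OF that(1)] that(2) by (intro min.mono mult_right_mono) auto
  show ?thesis unfolding Daniell_outer_def[of Y L E]
  proof (rule INF_greatest)
    fix F assume F: "F \<in> majorants Y E"
    note Fs = majorantsD[OF F]
    have in1: "(\<lambda>x. F j x * h i x) \<in> Cb Y" and in2: "(\<lambda>x. F j x * (1 - h i x)) \<in> Cb Y" for i j
      by (intro Cb_mult Cb_diff Cb_const Fs hCb)+
    have split: "L (F j) = L (\<lambda>x. F j x * h i x) + L (\<lambda>x. F j x * (1 - h i x))" for i j
      using L_linear(1)[OF in1 in2, of j i j i] by (simp add: algebra_simps)
    have inU: "\<mu> (E \<inter> U) \<le> (SUP j. ennreal (L (\<lambda>x. F j x * h j x)))"
    proof (rule outer_le, unfold majorants_def, intro CollectI conjI allI ballI)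
      fix j x assume x: "x \<in> topspace Y"
      show "0 \<le> F j x * h j x" using Fs(2) h01 x by simp
      show "F j x * h j x \<le> F (Suc j) x * h (Suc j) x"
        using Fs(2,3) h01 hmono x by (intro mult_mono) auto
    next
      fix x assume x: "x \<in> E \<inter> U"
      then have xY: "x \<in> topspace Y" and gx: "g x > 0" using E g(3) by auto
      obtain J where J: "real J * g x > 1" using reals_Archimedean3[OF gx] by blast
      obtain i where i: "1 \<le> F i x" using Fs(4) x by auto
      define k where "k = max i J"
      have "1 \<le> F k x" using i Fs(3)[OF xY, of i k] by (simp add: k_def)
      moreover have "h k x = 1"
        using hmono[OF xY, of J k] J h01[OF xY, of k] by (simp add: k_def h_def)
      ultimately show "\<exists>j. 1 \<le> F j x * h j x" by (intro exI[of _ k]) simp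
    qed (rule in1)
    \<comment> \<open>Here the cut-off index i stays frozen: \<open>h i\<close> vanishes off U, so
      the product still reaches 1 on \<open>E - U\<close>, whereas \<open>F j * (1 - h j)\<close>
      need not increase with j.\<close>
    have outU: "\<mu> (E - U) \<le> (SUP j. ennreal (L (\<lambda>x. F j x * (1 - h i x))))" for i
    proof (rule outer_le, unfold majorants_def, intro CollectI conjI allI ballI)
      fix j x assume x: "x \<in> topspace Y"
      show "0 \<le> F j x * (1 - h i x)" using Fs(2) h01 x by simp
      show "F j x * (1 - h i x) \<le> F (Suc j) x * (1 - h i x)"
        using Fs(2,3) h01 x by (intro mult_right_mono) auto
    next
      fix x assume x: "x \<in> E - U"
      then have "x \<in> topspace Y" "g x = 0" using E g(2)[of x] g(3) by auto
      then have "h i x = 0" by (simp add: h_def)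
      then show "\<exists>j. 1 \<le> F j x * (1 - h i x)" using Fs(4)[of x] x by auto
    qed (rule in2)
    have pos1: "0 \<le> L (\<lambda>x. F j x * h i x)" and pos2: "0 \<le> L (\<lambda>x. F j x * (1 - h i x))" for i j
      using Fs(2) h01 by (auto intro!: L_nonneg in1 in2)
    have "\<mu> (E \<inter> U) + \<mu> (E - U) \<le> (SUP i. ennreal (L (\<lambda>x. F i x * h i x))) + \<mu> (E - U)"
      by (rule add_right_mono[OF inU])
    also have "\<dots> = (SUP i. ennreal (L (\<lambda>x. F i x * h i x)) + \<mu> (E - U))"
      by (rule ennreal_SUP_add_left[symmetric]) simp
    also have "\<dots> \<le> (SUP j. ennreal (L (F j)))"
    proof (rule SUP_least)
      fix i
      have "ennreal (L (\<lambda>x. F i x * h i x)) + \<mu> (E - U)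
          \<le> ennreal (L (\<lambda>x. F i x * h i x)) + (SUP j. ennreal (L (\<lambda>x. F j x * (1 - h i x))))"
        by (rule add_left_mono[OF outU])
      also have "\<dots> = (SUP j. ennreal (L (\<lambda>x. F i x * h i x)) + ennreal (L (\<lambda>x. F j x * (1 - h i x))))"
        by (rule ennreal_SUP_add_right) simp
      also have "\<dots> \<le> (SUP j. ennreal (L (F j)))"
      proof (rule SUP_least)
        fix j
        \<comment> \<open>Both parts are raised to a common stage of F with the same cut-off
          \<open>h i\<close>, where they add up to \<open>F ?k\<close>.\<close>
        let ?k = "max i j"
        have "L (\<lambda>x. F i x * h i x) \<le> L (\<lambda>x. F ?k x * h i x)"
          by (rule mono[OF in1 in1]) (auto intro!: mult_right_mono Fs h01)
        moreover have "L (\<lambda>x. F j x * (1 - h i x)) \<le> L (\<lambda>x. F ?k x * (1 - h i x))"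
          by (rule mono[OF in2 in2]) (auto intro!: mult_right_mono Fs h01)
        ultimately have "L (\<lambda>x. F i x * h i x) + L (\<lambda>x. F j x * (1 - h i x)) \<le> L (F ?k)"
          unfolding split[of ?k i] by simp
        then have "ennreal (L (\<lambda>x. F i x * h i x)) + ennreal (L (\<lambda>x. F j x * (1 - h i x))) \<le> ennreal (L (F ?k))"
          using pos1 pos2 by (simp add: ennreal_plus[symmetric] ennreal_leI del: ennreal_plus)
        also have "\<dots> \<le> (SUP j. ennreal (L (F j)))" by (rule SUP_upper) simp
        finally show "ennreal (L (\<lambda>x. F i x * h i x)) + ennreal (L (\<lambda>x. F j x * (1 - h i x)))
            \<le> (SUP j. ennreal (L (F j)))" .
      qed
      finally show "ennreal (L (\<lambda>x. F i x * h i x)) + \<mu> (E - U) \<le> (SUP j. ennreal (L (F j)))" .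
    qed
    finally show "\<mu> (E \<inter> U) + \<mu> (E - U) \<le> (SUP j. ennreal (L (F j)))" .
  qed
qed

text \<open>Caratheodory measurable sets form a sigma-algebra, so it suffices to treat open sets.
  For these \<open>outer_split\<close> gives the substantial inequality and subadditivity the other
  one.\<close>

lemma borel_subset_lambda_system: "sets (borel_of Y) \<subseteq> lambda_system (topspace Y) (Pow (topspace Y)) \<mu>"
proof -
  interpret S: sigma_algebra "topspace Y" "Pow (topspace Y)" by (rule sigma_algebra_Pow)
  have ms: "measure_space (topspace Y) (lambda_system (topspace Y) (Pow (topspace Y)) \<mu>) \<mu>"
    by (rule S.caratheodory_lemma[OF outer_measure_space_outer])
  then interpret LS: sigma_algebra "topspace Y" "lambda_system (topspace Y) (Pow (topspace Y)) \<mu>"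
    by (simp add: measure_space_def)
  have "{U. openin Y U} \<subseteq> lambda_system (topspace Y) (Pow (topspace Y)) \<mu>"
    unfolding S.lambda_system_eq
  proof safe
    fix U E x assume U: "openin Y U" and E: "E \<subseteq> topspace Y"
    have "\<mu> E \<le> \<mu> (E \<inter> U) + \<mu> (E - U)"
    proof -
      \<comment> \<open>Padding with empty sets extracts binary subadditivity from the countable
        form.\<close>
      define A where "A i = (if i = 0 then E \<inter> U else if i = 1 then E - U else {})" for i :: nat
      have "\<mu> (\<Union>i. A i) \<le> (\<Sum>i. \<mu> (A i))" by (rule outer_UN_le) (use E in \<open>auto simp: A_def\<close>)
      also have "\<dots> = (\<Sum>i<2. \<mu> (A i))" by (rule suminf_finite) (auto simp: A_def outer_empty)
      also have "\<dots> = \<mu> (E \<inter> U) + \<mu> (E - U)" by (simp add: A_def numeral_2_eq_2)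
      also have "(\<Union>i. A i) = E"
      proof -
        have "A 0 \<union> A 1 = E" by (auto simp: A_def)
        moreover have "A i \<subseteq> E" for i by (auto simp: A_def)
        ultimately show ?thesis by blast
      qed
      finally show ?thesis .
    qed
    then show "\<mu> (E \<inter> U) + \<mu> (E - U) = \<mu> E" using outer_split[OF U E] by (rule antisym[rotated])
  qed (auto dest: openin_subset)
  then show ?thesis unfolding sets_borel_of by (rule LS.sigma_sets_subset)
qed

section \<open>The Daniell measure, its total mass and the integral representation\<close>

definition \<pi> :: "'b measure" where
  "\<pi> = measure_of (topspace Y) {U. openin Y U} \<mu>"

lemma sets_\<pi>: "sets \<pi> = sets (borel_of Y)"
  unfolding \<pi>_def sets_borel_of by (subst sets_measure_of) (auto dest: openin_subset)

lemma space_\<pi>: "space \<pi> = topspace Y"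
  using sets_eq_imp_space_eq[OF sets_\<pi>] by simp

lemma emeasure_\<pi>:
  assumes "A \<in> sets (borel_of Y)" shows "emeasure \<pi> A = \<mu> A"
proof (rule emeasure_measure_of[OF \<pi>_def])
  interpret S: sigma_algebra "topspace Y" "Pow (topspace Y)" by (rule sigma_algebra_Pow)
  have ms: "measure_space (topspace Y) (lambda_system (topspace Y) (Pow (topspace Y)) \<mu>) \<mu>"
    by (rule S.caratheodory_lemma[OF outer_measure_space_outer])
  show "countably_additive (sets \<pi>) \<mu>"
    using ms borel_subset_lambda_system unfolding sets_\<pi> measure_space_def countably_additive_def
    by (meson in_mono subset_trans)
  show "positive (sets \<pi>) \<mu>" by (simp add: positive_def outer_empty)
qed (use assms sets_\<pi> in \<open>auto dest: openin_subset\<close>)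

text \<open>This is where Daniell continuity enters. For a majorant F of the whole space the gaps
  \<open>max 0 (1 - F j)\<close> decrease pointwise to 0, so their L-values vanish in the limit and
  \<open>L (F j)\<close> catches up with \<open>L 1\<close>. For a merely finitely additive L the
  outer measure could fall short of that mass.\<close>

lemma outer_topspace: "\<mu> (topspace Y) = ennreal (L (\<lambda>x. 1))"
proof (rule antisym)
  show "\<mu> (topspace Y) \<le> ennreal (L (\<lambda>x. 1))" by (rule outer_le_L) (auto intro: Cb_const)
  show "ennreal (L (\<lambda>x. 1)) \<le> \<mu> (topspace Y)" unfolding Daniell_outer_def
  proof (rule INF_greatest)
    fix F assume F: "F \<in> majorants Y (topspace Y)"
    note Fs = majorantsD[OF F]
    define f where "f j x = max 0 (1 - F j x)" for j x
    have fCb: "f j \<in> Cb Y" for j unfolding f_def by (intro Cb_max Cb_diff Cb_const Fs(1))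
    have "(\<lambda>j. L (f j)) \<longlonglongrightarrow> 0"
    proof (rule cont[OF fCb])
      fix x assume x: "x \<in> topspace Y"
      obtain J where J: "1 \<le> F J x" using Fs(4)[OF x] by auto
      have "\<forall>\<^sub>F j in sequentially. f j x = 0"
        by (rule eventually_sequentiallyI[of J]) (use J Fs(3)[OF x] in \<open>force simp: f_def\<close>)
      then show "(\<lambda>j. f j x) \<longlonglongrightarrow> 0" by (rule tendsto_eventually)
    next
      fix j x assume x: "x \<in> topspace Y"
      show "f (Suc j) x \<le> f j x" using Fs(3)[OF x, of j "Suc j"] by (auto simp: f_def)
    qed (auto simp: f_def)
    then have lim: "(\<lambda>j. ennreal (L (\<lambda>x. 1) - L (f j))) \<longlonglongrightarrow> ennreal (L (\<lambda>x. 1) - 0)"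
      by (intro tendsto_ennrealI tendsto_diff tendsto_const)
    have le: "ennreal (L (\<lambda>x. 1) - L (f j)) \<le> (SUP j. ennreal (L (F j)))" for j
    proof -
      have "L (\<lambda>x. 1) \<le> L (\<lambda>x. f j x + F j x)"
        by (rule mono[OF Cb_const Cb_add[OF fCb Fs(1)]]) (simp add: f_def)
      also have "\<dots> = L (f j) + L (F j)" by (rule L_linear(1)[OF fCb Fs(1)])
      finally have "ennreal (L (\<lambda>x. 1) - L (f j)) \<le> ennreal (L (F j))" by (simp add: ennreal_leI)
      also have "\<dots> \<le> (SUP j. ennreal (L (F j)))" by (rule SUP_upper) simp
      finally show ?thesis .
    qed
    show "ennreal (L (\<lambda>x. 1)) \<le> (SUP j. ennreal (L (F j)))"
      using LIMSEQ_le_const2[OF lim] le by auto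
  qed
qed

lemma finite_measure_\<pi>: "finite_measure \<pi>"
  by (rule finite_measureI) (simp add: space_\<pi> emeasure_\<pi> outer_topspace closedin_borel_of)

lemma measure_\<pi>_topspace: "measure \<pi> (topspace Y) = L (\<lambda>x. 1)"
  unfolding measure_def using L_nonneg[OF Cb_const, of 1]
  by (simp add: emeasure_\<pi> outer_topspace closedin_borel_of)

text \<open>Each summand is the length of the part of the interval from 0 to y that lies between i
  and i + 1.\<close>

lemma sum_min_max:
  fixes y :: real assumes "0 \<le> y"
  shows "(\<Sum>i<N. min 1 (max 0 (y - real i))) = min y (real N)"
  using assms by (induction N) (auto simp: min_def max_def)

text \<open>The sum counts the complete unit layers below y, and the summand 1 pays for the
  incomplete one. After division by N it becomes the vanishing error in the layer-cake
  estimate.\<close>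

lemma min_le_sum_of_bool:
  fixes y :: real
  shows "min y (real N) \<le> 1 + (\<Sum>i<N. of_bool (real i + 1 \<le> y))"
proof (induction N)
  case (Suc N)
  show ?case
  proof (cases "y < real N")
    case True then show ?thesis using Suc by simp
  next
    case False
    have "(\<Sum>i<N. of_bool (real i + 1 \<le> y)) = (\<Sum>i<N. (1::real))"
      by (rule sum.cong) (use False in auto)
    then show ?thesis using False by (auto simp: min_def)
  qed
qed (simp add: min_def)

text \<open>Layer cake: up to 1/N, f is the average of the indicators of the sets f \<ge> (i + 1) / N,
  each of which is majorized by a slice h i of N * f.\<close>

lemma integral_le_L:
  assumes f: "f \<in> Cb Y" and f01: "\<And>x. x \<in> topspace Y \<Longrightarrow> 0 \<le> f x \<and> f x \<le> 1"
  shows "(\<integral>x. f x \<partial>\<pi>) \<le> L f"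
proof -
  interpret finite_measure \<pi> by (rule finite_measure_\<pi>)
  have le: "(\<integral>x. f x \<partial>\<pi>) \<le> L f + measure \<pi> (topspace Y) / real N" if N: "N > 0" for N :: nat
  proof -
    define h where "h i x = min 1 (max 0 (real N * f x - real i))" for i x
    have hCb: "h i \<in> Cb Y" for i unfolding h_def by (intro Cb_min Cb_max Cb_diff Cb_mult Cb_const f)
    define S where "S i = {x \<in> topspace Y. real i + 1 \<le> real N * f x}" for i
    have S_sets: "S i \<in> sets (borel_of Y)" for i
    proof -
      have "continuous_map Y euclideanreal (\<lambda>x. real N * f x)"
        by (intro Cb_cont Cb_mult Cb_const f)
      then have "closedin Y {x \<in> topspace Y. real N * f x \<in> {real i + 1..}}"
        by (rule closedin_continuous_map_preimage) auto
      then show ?thesis unfolding S_def by (auto intro: closedin_borel_of)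
    qed
    have meas: "measure \<pi> (S i) \<le> L (h i)" for i
    proof -
      have "emeasure \<pi> (S i) \<le> ennreal (L (h i))"
        unfolding emeasure_\<pi>[OF S_sets] by (rule outer_le_L[OF hCb]) (auto simp: h_def S_def)
      moreover have "0 \<le> L (h i)" by (rule L_nonneg[OF hCb]) (auto simp: h_def)
      ultimately show ?thesis by (simp add: emeasure_eq_measure)
    qed
    have int_ind: "integrable \<pi> (\<lambda>x. indicator (S i) x :: real)" for i
      using S_sets sets_\<pi> by (simp add: emeasure_eq_measure)
    have "real N * (\<integral>x. f x \<partial>\<pi>) = (\<integral>x. real N * f x \<partial>\<pi>)" by simp
    also have "\<dots> \<le> (\<integral>x. 1 + (\<Sum>i<N. indicator (S i) x) \<partial>\<pi>)"
    proof (rule integral_mono)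
      show "integrable \<pi> (\<lambda>x. real N * f x)"
        using integrable_Cb[OF finite_measure_\<pi> sets_\<pi> f] by simp
      show "integrable \<pi> (\<lambda>x. 1 + (\<Sum>i<N. indicator (S i) x) :: real)"
        using int_ind by auto
      fix x assume "x \<in> space \<pi>"
      then have x: "x \<in> topspace Y" by (simp add: space_\<pi>)
      have "real N * f x \<le> real N" using f01[OF x] by (simp add: mult_left_le)
      then have "real N * f x \<le> 1 + (\<Sum>i<N. of_bool (real i + 1 \<le> real N * f x))"
        using min_le_sum_of_bool[of "real N * f x" N] by simp
      also have "(\<Sum>i<N. of_bool (real i + 1 \<le> real N * f x)) = (\<Sum>i<N. indicator (S i) x :: real)"
        by (rule sum.cong) (use x in \<open>auto simp: S_def indicator_def\<close>)
      finally show "real N * f x \<le> 1 + (\<Sum>i<N. indicator (S i) x)" .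
    qed
    also have "\<dots> = measure \<pi> (topspace Y) + (\<Sum>i<N. measure \<pi> (S i))"
    proof -
      have "S i \<inter> topspace Y = S i" for i by (auto simp: S_def)
      then show ?thesis
        using int_ind S_sets sets_\<pi> space_\<pi> by (subst Bochner_Integration.integral_add) auto
    qed
    also have "(\<Sum>i<N. measure \<pi> (S i)) \<le> (\<Sum>i<N. L (h i))" by (rule sum_mono[OF meas])
    also have "\<dots> = L (\<lambda>x. \<Sum>i<N. h i x)" using L_sum[of "{..<N}" h] hCb by simp
    also have "\<dots> \<le> L (\<lambda>x. real N * f x)"
    proof (rule mono)
      show "(\<lambda>x. \<Sum>i<N. h i x) \<in> Cb Y" using L_sum[of "{..<N}" h] hCb by simp
      show "(\<lambda>x. real N * f x) \<in> Cb Y" by (intro Cb_mult Cb_const f)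
      show "(\<Sum>i<N. h i x) \<le> real N * f x" if "x \<in> topspace Y" for x
        unfolding h_def using f01[OF that] by (subst sum_min_max) auto
    qed
    also have "\<dots> = real N * L f" by (rule L_linear(2)[OF f])
    finally show ?thesis using N by (simp add: field_simps)
  qed
  have "(\<lambda>N. L f + measure \<pi> (topspace Y) / real N) \<longlonglongrightarrow> L f + 0"
    by (intro tendsto_add tendsto_const lim_const_over_n)
  then have "(\<integral>x. f x \<partial>\<pi>) \<le> L f + 0"
    by (rule LIMSEQ_le_const) (use le in \<open>auto intro!: exI[of _ 1]\<close>)
  then show ?thesis by simp
qed

text \<open>The one-sided bound holds for g and for \<open>1 - g\<close>. Integrals and L-values of
  these two add up to the same total mass, so both bounds are equalities; an affine rescaling
  reduces f to such a g.\<close>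

lemma integral_eq_L:
  assumes f: "f \<in> Cb Y"
  shows "(\<integral>x. f x \<partial>\<pi>) = L f"
proof -
  interpret finite_measure \<pi> by (rule finite_measure_\<pi>)
  have int: "integrable \<pi> g" if "g \<in> Cb Y" for g by (rule integrable_Cb[OF finite_measure_\<pi> sets_\<pi> that])
  have eq01: "(\<integral>x. g x \<partial>\<pi>) = L g" if g: "g \<in> Cb Y" "\<And>x. x \<in> topspace Y \<Longrightarrow> 0 \<le> g x \<and> g x \<le> 1" for g
  proof (rule antisym)
    show "(\<integral>x. g x \<partial>\<pi>) \<le> L g" by (rule integral_le_L[OF g])
    have "(\<integral>x. 1 - g x \<partial>\<pi>) \<le> L (\<lambda>x. 1 - g x)"
      by (rule integral_le_L) (use g in \<open>auto intro: Cb_diff Cb_const\<close>)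
    moreover have "(\<integral>x. 1 - g x \<partial>\<pi>) = L (\<lambda>x. 1) - (\<integral>x. g x \<partial>\<pi>)"
      using int[OF g(1)] measure_\<pi>_topspace by (simp add: space_\<pi>)
    moreover have "L (\<lambda>x. 1 - g x) = L (\<lambda>x. 1) - L g"
      by (rule L_linear(4)[OF Cb_subspace Cb_const g(1)])
    ultimately show "L g \<le> (\<integral>x. g x \<partial>\<pi>)" by simp
  qed
  obtain B where B: "\<And>y. y \<in> topspace Y \<Longrightarrow> \<bar>f y\<bar> \<le> B" using f by (auto simp: Cb_def)
  \<comment> \<open>The maximum with 1 makes the bound positive, so that dividing by
    \<open>2 * C\<close> maps the range of f into the unit interval.\<close>
  define C where "C = max B 1"
  have C: "C > 0" "\<And>y. y \<in> topspace Y \<Longrightarrow> \<bar>f y\<bar> \<le> C" using B by (force simp: C_def)+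
  define g where "g x = 1 / (2 * C) * (f x + C)" for x
  have gCb: "g \<in> Cb Y" unfolding g_def by (intro Cb_mult Cb_add Cb_const f)
  have feq: "f = (\<lambda>x. 2 * C * g x - C)" using C(1) by (auto simp: g_def fun_eq_iff field_simps)
  have "(\<integral>x. g x \<partial>\<pi>) = L g"
  proof (rule eq01[OF gCb])
    fix x assume "x \<in> topspace Y"
    then have "\<bar>f x\<bar> \<le> C" by (rule C(2))
    then show "0 \<le> g x \<and> g x \<le> 1" using C(1) by (auto simp: g_def field_simps)
  qed
  moreover have "(\<integral>x. f x \<partial>\<pi>) = 2 * C * (\<integral>x. g x \<partial>\<pi>) - C * L (\<lambda>x. 1)"
    using int[OF gCb] measure_\<pi>_topspace by (subst feq) (simp add: space_\<pi>)
  moreover have "L f = 2 * C * L g - C * L (\<lambda>x. 1)"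
  proof -
    have c: "L (\<lambda>x. C) = C * L (\<lambda>x. 1)" using L_linear(2)[OF Cb_const, of C 1] by simp
    have "L f = L (\<lambda>x. 2 * C * g x - C)" using feq by metis
    also have "\<dots> = L (\<lambda>x. 2 * C * g x) - L (\<lambda>x. C)"
      by (rule L_linear(4)[OF Cb_subspace _ Cb_const]) (intro Cb_mult Cb_const gCb)
    also have "L (\<lambda>x. 2 * C * g x) = 2 * C * L g" by (rule L_linear(2)[OF gCb])
    finally show ?thesis unfolding c .
  qed
  ultimately show ?thesis by simp
qed

end

section \<open>Tightness and a Dini theorem on products\<close>

text \<open>Ulam's theorem. For each radius \<open>1 / Suc m\<close>, finitely many closed balls
  around a dense sequence miss at most \<open>e / 2 ^ Suc m\<close> of the mass. The intersection K
  of these finite unions is closed and totally bounded, hence compact by completeness, and the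
  losses add up to at most e.\<close>

lemma Polish_tight:
  assumes Y: "Polish_space Y" and N: "finite_measure N" "sets N = sets (borel_of Y)" and e: "e > 0"
  obtains K where "compactin Y K" "measure N (topspace Y - K) \<le> e"
proof (cases "topspace Y = {}")
  case True
  then show ?thesis using that[of "{}"] e by simp
next
  case False
  interpret N: finite_measure N by fact
  have spN: "space N = topspace Y" by (rule space_eq_topspace[OF N(2)])
  obtain M d where "Metric_space M d" and comp: "Metric_space.mcomplete M d"
    and Yd: "Y = Metric_space.mtopology M d"
    using Y by (auto simp: Polish_space_def completely_metrizable_space_def)
  interpret Metric_space M d by fact
  have M: "topspace Y = M" using Yd by simp
  obtain C where C: "countable C" "C \<subseteq> M" "mtopology closure_of C = M"
    using Y Yd unfolding Polish_space_def separable_space_def by auto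
  have Cne: "C \<noteq> {}" using C False M by auto
  define c where "c = from_nat_into C"
  have cC: "range c = C" unfolding c_def by (rule range_from_nat_into[OF Cne C(1)])
  define A where "A m k = (\<Union>l\<le>k. mcball (c l) (1 / real (Suc m)))" for m k
  have A_closed: "closedin Y (A m k)" for m k
    unfolding A_def Yd by (intro closedin_Union) auto
  have A_sets: "A m k \<in> sets N" for m k using closedin_borel_of[OF A_closed] N(2) by simp
  have A_UN: "(\<Union>k. A m k) = M" for m
  proof
    show "(\<Union>k. A m k) \<subseteq> M" unfolding A_def by auto
    show "M \<subseteq> (\<Union>k. A m k)"
    proof
      fix x assume "x \<in> M"
      then have "\<forall>r>0. \<exists>y\<in>C. y \<in> mball x r" using C(3) metric_closure_of by auto
      then obtain y where y: "y \<in> C" "y \<in> mball x (1 / real (Suc m))"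
        by (metis of_nat_0_less_iff zero_less_Suc zero_less_divide_1_iff)
      then obtain l where "y = c l" using cC by auto
      then have "x \<in> mcball (c l) (1 / real (Suc m))" using y by (auto simp: commute)
      then show "x \<in> (\<Union>k. A m k)" unfolding A_def by auto
    qed
  qed
  have "\<exists>k. measure N (M - A m k) \<le> e * (1/2) ^ Suc m" for m
  proof -
    have "(\<lambda>k. measure N (A m k)) \<longlonglongrightarrow> measure N (\<Union>k. A m k)"
      by (rule N.finite_Lim_measure_incseq) (use A_sets in \<open>force simp: A_def incseq_def\<close>)+
    then have "(\<lambda>k. measure N (A m k)) \<longlonglongrightarrow> measure N M" unfolding A_UN .
    then have "\<forall>\<^sub>F k in sequentially. measure N M - e * (1/2) ^ Suc m < measure N (A m k)"
      by (rule order_tendstoD) (use e in simp)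
    then obtain k where "measure N M - e * (1/2) ^ Suc m < measure N (A m k)"
      by (auto simp: eventually_sequentially)
    moreover have "measure N (M - A m k) = measure N M - measure N (A m k)"
      using N.finite_measure_compl[OF A_sets, of m k] spN M by simp
    ultimately show ?thesis by (intro exI[of _ k]) simp
  qed
  then obtain n where n: "\<And>m. measure N (M - A m (n m)) \<le> e * (1/2) ^ Suc m" by metis
  define K where "K = (\<Inter>m. A m (n m))"
  have KM: "K \<subseteq> M" unfolding K_def using A_UN by blast
  have K_closed: "closedin Y K" unfolding K_def by (intro closedin_INT A_closed) auto
  have "mtotally_bounded K" unfolding mtotally_bounded_def
  proof (intro allI impI)
    fix r :: real assume r: "r > 0"
    obtain m where m: "1 / real (Suc m) < r / 2"
      using reals_Archimedean[of "r/2"] r by (auto simp: inverse_eq_divide)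
    \<comment> \<open>Total boundedness asks for centres inside K, but the points \<open>c l\<close>
      may lie outside. Each ball that meets K is recentred at a point of K, which doubles the
      radius; hence the choice of m with \<open>r / 2\<close>.\<close>
    define B where "B l = K \<inter> mcball (c l) (1 / real (Suc m))" for l
    define p where "p l = (SOME x. x \<in> B l)" for l
    have p: "p l \<in> B l" if "B l \<noteq> {}" for l unfolding p_def using that some_in_eq by blast
    show "\<exists>F. finite F \<and> F \<subseteq> K \<and> K \<subseteq> (\<Union>x\<in>F. mball x r)"
    proof (intro exI conjI)
      show "finite (p ` {l. l \<le> n m \<and> B l \<noteq> {}})" by simp
      show "p ` {l. l \<le> n m \<and> B l \<noteq> {}} \<subseteq> K" using p by (auto simp: B_def)
      show "K \<subseteq> (\<Union>x\<in>p ` {l. l \<le> n m \<and> B l \<noteq> {}}. mball x r)"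
      proof
        fix x assume x: "x \<in> K"
        then have "x \<in> A m (n m)" by (auto simp: K_def)
        then obtain l where l: "l \<le> n m" "x \<in> B l" using x by (auto simp: A_def B_def)
        then have ne: "B l \<noteq> {}" by auto
        have "d (p l) x \<le> d (p l) (c l) + d (c l) x"
          using p[OF ne] l(2) by (intro triangle) (auto simp: B_def)
        also have "\<dots> \<le> 1 / real (Suc m) + 1 / real (Suc m)"
          using p[OF ne] l(2) by (intro add_mono) (auto simp: B_def commute)
        also have "\<dots> < r" using m by simp
        finally have "x \<in> mball (p l) r" using p[OF ne] l(2) by (auto simp: B_def)
        then show "x \<in> (\<Union>x\<in>p ` {l. l \<le> n m \<and> B l \<noteq> {}}. mball x r)" using l ne by auto
      qed
    qed
  qed
  then have "compactin Y K"
    using mtotally_bounded_eq_compact_closure_of[OF comp] K_closed Yd by (simp add: closure_of_closedin)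
  moreover have "measure N (topspace Y - K) \<le> e"
  proof -
    have s: "(\<lambda>m. e * (1/2) ^ Suc m) sums e" using sums_mult[OF power_half_series, of e] by simp
    have sm: "summable (\<lambda>m. measure N (M - A m (n m)))"
      by (rule summable_comparison_test'[OF sums_summable[OF s]]) (use n in auto)
    have "topspace Y - K = (\<Union>m. M - A m (n m))" unfolding K_def M by auto
    also have "measure N \<dots> \<le> (\<Sum>m. measure N (M - A m (n m)))"
      by (rule N.finite_measure_subadditive_countably[OF _ sm])
        (use A_sets spN M in \<open>auto intro!: sets.compl_sets simp flip: spN M\<close>)
    also have "\<dots> \<le> (\<Sum>m. e * (1/2) ^ Suc m)" by (rule suminf_le[OF n sm sums_summable[OF s]])
    finally show ?thesis using sums_unique[OF s] by simp
  qed
  ultimately show ?thesis by (rule that)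
qed

text \<open>Off a small neighbourhood of the compact box with sides K i some coordinate cut-off equals 1,
  so the supremum of c J is controlled by e and functions of single coordinates.\<close>

lemma product_Dini:
  fixes X :: "'i \<Rightarrow> 'a topology"
  assumes I: "finite I" and X: "\<And>i. i \<in> I \<Longrightarrow> metrizable_space (X i)"
    and K: "\<And>i. i \<in> I \<Longrightarrow> compactin (X i) (K i)"
    and c: "\<And>j. continuous_map (product_topology X I) euclideanreal (c j)"
    and c_dec: "\<And>j x. x \<in> topspace (product_topology X I) \<Longrightarrow> c (Suc j) x \<le> c j x"
    and c_lim: "\<And>x. x \<in> topspace (product_topology X I) \<Longrightarrow> (\<lambda>j. c j x) \<longlonglongrightarrow> 0"
    and e: "e > (0::real)"
  shows "\<exists>\<phi> J. (\<forall>i\<in>I. continuous_map (X i) euclideanreal (\<phi> i) \<and>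
      (\<forall>x\<in>topspace (X i). 0 \<le> \<phi> i x \<and> \<phi> i x \<le> (1::real)) \<and> (\<forall>x\<in>K i. \<phi> i x = 0)) \<and>
    (\<forall>x\<in>topspace (product_topology X I). c J x < e \<or> (\<exists>i\<in>I. \<phi> i (x i) = 1))"
proof -
  let ?P = "product_topology X I"
  have "\<exists>M d. Metric_space M d \<and> X i = Metric_space.mtopology M d" if "i \<in> I" for i
    using X[OF that] by (auto simp: metrizable_space_def)
  then obtain M d where Md: "\<And>i. i \<in> I \<Longrightarrow> Metric_space (M i) (d i)"
    and Xd: "\<And>i. i \<in> I \<Longrightarrow> X i = Metric_space.mtopology (M i) (d i)" by metis
  have top: "topspace (X i) = M i" if "i \<in> I" for i
    using Xd[OF that] Metric_space.topspace_mtopology[OF Md[OF that]] by simp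
  have KM: "K i \<subseteq> M i" if "i \<in> I" for i using compactin_subset_topspace[OF K[OF that]] top[OF that] by simp
  have K_comp: "compactin ?P (Pi\<^sub>E I K)" using K by (simp add: compactin_PiE)
  have dec: "c k x \<le> c j x" if "x \<in> topspace ?P" "j \<le> k" for j k x
    using that(2) by (rule lift_Suc_antimono_le[rotated]) (use c_dec that in auto)
  \<comment> \<open>The factor 2 leaves room for a triangle inequality: the cover below uses radius
    \<open>r y\<close>, and points a little away from the compact box must still be controlled.
    Neighbourhoods are boxes of coordinate balls, so no metric on the product has to be
    chosen.\<close>
  have "\<exists>j r. r > 0 \<and> (\<forall>x\<in>topspace ?P. (\<forall>i\<in>I. d i (y i) (x i) < 2 * r) \<longrightarrow> c j x < e)"
    if y: "y \<in> Pi\<^sub>E I K" for y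
  proof -
    have yP: "y \<in> topspace ?P" using y KM top by (fastforce simp: PiE_iff)
    have "\<forall>\<^sub>F j in sequentially. c j y < e" by (rule order_tendstoD(2)[OF c_lim[OF yP] e])
    then obtain j where j: "c j y < e" by (auto simp: eventually_sequentially)
    let ?V = "{x \<in> topspace ?P. c j x \<in> {..<e}}"
    have "openin ?P ?V" by (rule openin_continuous_map_preimage[OF c]) auto
    moreover have "y \<in> ?V" using j yP by simp
    ultimately have "\<exists>U. finite {i \<in> I. U i \<noteq> topspace (X i)} \<and> (\<forall>i\<in>I. openin (X i) (U i))
        \<and> y \<in> Pi\<^sub>E I U \<and> Pi\<^sub>E I U \<subseteq> ?V"
      unfolding openin_product_topology_alt by (rule bspec)
    then obtain U where U0: "\<forall>i\<in>I. openin (X i) (U i)" and U: "y \<in> Pi\<^sub>E I U" "Pi\<^sub>E I U \<subseteq> ?V"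
      by (elim exE conjE) (rule that)
    have "\<exists>r>0. Metric_space.mball (M i) (d i) (y i) r \<subseteq> U i" if i: "i \<in> I" for i
      using Metric_space.openin_mtopology[OF Md[OF i]] U0 U(1) Xd[OF i] i by (auto simp: PiE_iff)
    then obtain r where r: "\<And>i. i \<in> I \<Longrightarrow> r i > 0 \<and> Metric_space.mball (M i) (d i) (y i) (r i) \<subseteq> U i"
      by metis
    \<comment> \<open>The inserted 1 keeps the minimum meaningful for an empty index set.\<close>
    define s where "s = Min (insert 1 (r ` I))"
    have s: "s > 0" "\<And>i. i \<in> I \<Longrightarrow> s \<le> r i" unfolding s_def using I r by auto
    have "c j x < e" if x: "x \<in> topspace ?P" and dx: "\<forall>i\<in>I. d i (y i) (x i) < 2 * (s / 2)" for x
    proof -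
      have "x i \<in> U i" if i: "i \<in> I" for i
      proof -
        have "d i (y i) (x i) < r i" using dx s(2)[OF i] i by fastforce
        moreover have "x i \<in> M i" "y i \<in> M i" using x yP i top[OF i] by (auto simp: PiE_iff)
        ultimately show ?thesis using r[OF i] Metric_space.in_mball[OF Md[OF i]] by blast
      qed
      then have "x \<in> Pi\<^sub>E I U" using x by (auto simp: PiE_iff)
      then show ?thesis using U(2) by blast
    qed
    then show ?thesis using s(1) by (intro exI[of _ j] exI[of _ "s / 2"]) auto
  qed
  then obtain j r where r: "\<And>y. y \<in> Pi\<^sub>E I K \<Longrightarrow> r y > 0"
    and jr: "\<And>y x. y \<in> Pi\<^sub>E I K \<Longrightarrow> x \<in> topspace ?P \<Longrightarrow> (\<forall>i\<in>I. d i (y i) (x i) < 2 * r y) \<Longrightarrow> c (j y) x < e"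
    by metis
  define W where "W y = (\<Pi>\<^sub>E i\<in>I. Metric_space.mball (M i) (d i) (y i) (r y))" for y
  have W_open: "openin ?P (W y)" for y unfolding W_def
    using I Xd Metric_space.openin_mball[OF Md] by (simp add: openin_PiE)
  have yW: "y \<in> W y" if y: "y \<in> Pi\<^sub>E I K" for y
    unfolding W_def PiE_iff
  proof (intro conjI ballI)
    fix i assume i: "i \<in> I"
    have "y i \<in> M i" using y i KM[OF i] by (auto simp: PiE_iff)
    then show "y i \<in> Metric_space.mball (M i) (d i) (y i) (r y)"
      using Metric_space.centre_in_mball_iff[OF Md[OF i]] r[OF y] by simp
  qed (use y in \<open>simp add: PiE_iff\<close>)
  have "\<exists>\<F>. finite \<F> \<and> \<F> \<subseteq> W ` Pi\<^sub>E I K \<and> Pi\<^sub>E I K \<subseteq> \<Union>\<F>"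
  proof (rule compactinD[OF K_comp])
    show "openin ?P U" if "U \<in> W ` Pi\<^sub>E I K" for U using that W_open by blast
    show "Pi\<^sub>E I K \<subseteq> \<Union>(W ` Pi\<^sub>E I K)" using yW by blast
  qed
  then obtain T where T: "finite T" "T \<subseteq> Pi\<^sub>E I K" "Pi\<^sub>E I K \<subseteq> (\<Union>y\<in>T. W y)"
    using finite_subset_image by metis
  define J where "J = Max (insert 0 (j ` T))"
  define \<rho> where "\<rho> = Min (insert 1 (r ` T))"
  have J: "j y \<le> J" if "y \<in> T" for y unfolding J_def using that T by auto
  have \<rho>: "\<rho> > 0" "\<And>y. y \<in> T \<Longrightarrow> \<rho> \<le> r y" unfolding \<rho>_def using T r by (auto simp: subset_iff)
  \<comment> \<open>This is the distance to \<open>K i\<close> in units of \<rho>, capped at 1, so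
    it equals 1 exactly at distance at least \<rho>. For empty \<open>K i\<close> the constant 1
    places every point in the second alternative.\<close>
  define \<phi> where "\<phi> i x = (if K i = {} then 1 else min 1 ((INF a\<in>K i. d i x a) / \<rho>))" for i x
  have bd: "bdd_below (d i x ` K i)" if "i \<in> I" for i x
    using Metric_space.bdd_below_dist[OF Md[OF that]] .
  have dnn: "0 \<le> d i x y" if "i \<in> I" for i x y using Metric_space.nonneg[OF Md[OF that]] .
  show ?thesis
  proof (intro exI[of _ \<phi>] exI[of _ J] conjI ballI)
    fix i assume i: "i \<in> I"
    show "continuous_map (X i) euclideanreal (\<phi> i)"
    proof (cases "K i = {}")
      case False
      have "continuous_map (X i) euclideanreal (\<lambda>x. INF a\<in>K i. d i x a)"
        unfolding Xd[OF i] by (rule Metric_space.continuous_map_INF_dist[OF Md[OF i] KM[OF i] False])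
      then have "continuous_map (X i) euclideanreal (\<lambda>x. min 1 ((INF a\<in>K i. d i x a) / \<rho>))"
        using \<rho>(1) by (intro continuous_map_real_min continuous_map_real_divide) auto
      moreover have "\<phi> i = (\<lambda>x. min 1 ((INF a\<in>K i. d i x a) / \<rho>))"
        using False by (simp add: \<phi>_def fun_eq_iff)
      ultimately show ?thesis by simp
    next
      case True
      then have "\<phi> i = (\<lambda>x. 1)" by (simp add: \<phi>_def fun_eq_iff)
      then show ?thesis by simp
    qed
    show "0 \<le> \<phi> i x" "\<phi> i x \<le> 1" for x
      using \<rho>(1) dnn[OF i] by (auto simp: \<phi>_def intro!: divide_nonneg_nonneg cINF_greatest)
    show "\<phi> i x = 0" if x: "x \<in> K i" for x
    proof -
      have xM: "x \<in> M i" using x KM[OF i] by auto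
      have "(INF a\<in>K i. d i x a) \<le> d i x x" by (rule cINF_lower[OF bd[OF i] x])
      moreover have "d i x x = 0" using Metric_space.mdist_zero[OF Md[OF i] xM] .
      moreover have "0 \<le> (INF a\<in>K i. d i x a)" by (rule cINF_greatest) (use x dnn[OF i] in auto)
      ultimately have "(INF a\<in>K i. d i x a) = 0" by linarith
      then show ?thesis using x by (auto simp: \<phi>_def)
    qed
  next
    fix x assume x: "x \<in> topspace ?P"
    show "c J x < e \<or> (\<exists>i\<in>I. \<phi> i (x i) = 1)"
    proof (rule disjCI)
      assume n1: "\<not> (\<exists>i\<in>I. \<phi> i (x i) = 1)"
      \<comment> \<open>No cut-off equals 1, so x is within \<rho> of the compact box in every
        coordinate. The nearby point z lies in some \<open>W y\<close>, and
        \<open>\<rho> \<le> r y\<close> keeps x within \<open>2 * r y\<close> of y.\<close>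
      have "\<exists>z\<in>K i. d i (x i) z < \<rho>" if i: "i \<in> I" for i
      proof (rule ccontr)
        assume H: "\<not> (\<exists>z\<in>K i. d i (x i) z < \<rho>)"
        show False
        proof (cases "K i = {}")
          case True then show ?thesis using n1 i by (auto simp: \<phi>_def)
        next
          case False
          have "\<rho> \<le> (INF a\<in>K i. d i (x i) a)" by (rule cINF_greatest[OF False]) (use H in auto)
          then have "\<phi> i (x i) = 1" using False \<rho>(1) by (simp add: \<phi>_def)
          then show ?thesis using n1 i by auto
        qed
      qed
      then obtain z where z: "\<And>i. i \<in> I \<Longrightarrow> z i \<in> K i \<and> d i (x i) (z i) < \<rho>" by metis
      have "restrict z I \<in> Pi\<^sub>E I K" using z by auto
      then obtain y where y: "y \<in> T" "restrict z I \<in> W y" using T(3) by blast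
      have yK: "y \<in> Pi\<^sub>E I K" using y T by auto
      have "c (j y) x < e"
      proof (rule jr[OF yK x], rule ballI)
        fix i assume i: "i \<in> I"
        have "z i \<in> Metric_space.mball (M i) (d i) (y i) (r y)" using y(2) i by (auto simp: W_def PiE_iff)
        then have 1: "y i \<in> M i" "z i \<in> M i" "d i (y i) (z i) < r y"
          using Metric_space.in_mball[OF Md[OF i]] by auto
        have xM: "x i \<in> M i" using x i top[OF i] by (auto simp: PiE_iff)
        have "d i (y i) (x i) \<le> d i (y i) (z i) + d i (z i) (x i)"
          by (rule Metric_space.triangle[OF Md[OF i]]) (use 1 xM in auto)
        moreover have "d i (z i) (x i) < \<rho>" using z[OF i] Metric_space.commute[OF Md[OF i]] by metis
        ultimately show "d i (y i) (x i) < 2 * r y" using 1(3) \<rho>(2)[OF y(1)] by simp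
      qed
      then show "c J x < e" using dec[OF x J[OF y(1)]] by simp
    qed
  qed
qed

section \<open>Multi-marginal duality\<close>

lemma Polish_imp_metrizable: "Polish_space Y \<Longrightarrow> metrizable_space Y"
  by (simp add: Polish_space_def completely_metrizable_imp_metrizable_space)

text \<open>\<open>I_cover\<close> gives each coordinate a marginal, the source of tightness, and
  \<open>I_nonempty\<close> makes constants expressible by potentials. \<open>F_cut\<close> yields
  absolute values of potentials and the error terms of truncation.\<close>

locale multimarginal =
  fixes X :: "'i \<Rightarrow> 'a topology" and J :: "'i set" and I :: "'i set set"
    and \<mu> :: "'i set \<Rightarrow> ('i \<Rightarrow> 'a) measure" and F :: "'i set \<Rightarrow> (('i \<Rightarrow> 'a) \<Rightarrow> real) set"
  assumes finite_J: "finite J" and I_cover: "\<Union>I = J" and I_nonempty: "I \<noteq> {}"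
    and polish: "\<And>i. i \<in> J \<Longrightarrow> Polish_space (X i)"
    and mu_prob: "\<And>\<alpha>. \<alpha> \<in> I \<Longrightarrow> prob_space (\<mu> \<alpha>)"
    and mu_sets: "\<And>\<alpha>. \<alpha> \<in> I \<Longrightarrow> sets (\<mu> \<alpha>) = sets (borel_of (product_topology X \<alpha>))"
    and F_Cb: "\<And>\<alpha> f. \<alpha> \<in> I \<Longrightarrow> f \<in> Cb (product_topology X \<alpha>) \<Longrightarrow> f \<in> F \<alpha>"
    and F_CL: "\<And>\<alpha> f. \<alpha> \<in> I \<Longrightarrow> f \<in> F \<alpha> \<Longrightarrow> f \<in> CL (product_topology X \<alpha>) (\<mu> \<alpha>)"
    and F_add: "\<And>\<alpha> f g. \<alpha> \<in> I \<Longrightarrow> f \<in> F \<alpha> \<Longrightarrow> g \<in> F \<alpha> \<Longrightarrow> (\<lambda>x. f x + g x) \<in> F \<alpha>"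
    and F_scale: "\<And>\<alpha> f a. \<alpha> \<in> I \<Longrightarrow> f \<in> F \<alpha> \<Longrightarrow> (\<lambda>x. a * f x) \<in> F \<alpha>"
    and F_cut: "\<And>\<alpha> f t. \<alpha> \<in> I \<Longrightarrow> f \<in> F \<alpha> \<Longrightarrow> (\<lambda>x. max 0 (f x - t)) \<in> F \<alpha>"
begin

abbreviation P where "P \<equiv> product_topology X J"

definition tsum :: "('i set \<Rightarrow> ('i \<Rightarrow> 'a) \<Rightarrow> real) \<Rightarrow> ('i \<Rightarrow> 'a) \<Rightarrow> real" where
  "tsum f = (\<lambda>x. \<Sum>\<alpha>\<in>I. f \<alpha> (restrict x \<alpha>))"

definition tint :: "('i set \<Rightarrow> ('i \<Rightarrow> 'a) \<Rightarrow> real) \<Rightarrow> real" where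
  "tint f = (\<Sum>\<alpha>\<in>I. \<integral>y. f \<alpha> y \<partial>(\<mu> \<alpha>))"

definition pot :: "('i set \<Rightarrow> ('i \<Rightarrow> 'a) \<Rightarrow> real) set" where
  "pot = {f. \<forall>\<alpha>\<in>I. f \<alpha> \<in> F \<alpha>}"

text \<open>The growth bound makes both c and its negative superhedgeable, so no price is an infimum
  over the empty set. For integrable potentials this is the class \<open>CLX\<close>; for bounded
  ones it is \<open>Cb P\<close>.\<close>

definition V :: "(('i \<Rightarrow> 'a) \<Rightarrow> real) set" where
  "V = {c. continuous_map P euclideanreal c \<and> (\<exists>g\<in>pot. \<forall>x\<in>topspace P. \<bar>c x\<bar> \<le> tsum g x)}"

definition superhedges :: "(('i \<Rightarrow> 'a) \<Rightarrow> real) \<Rightarrow> ('i set \<Rightarrow> ('i \<Rightarrow> 'a) \<Rightarrow> real) set" where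
  "superhedges c = {f\<in>pot. \<forall>x\<in>topspace P. c x \<le> tsum f x}"

definition plans :: "('i \<Rightarrow> 'a) measure set" where
  "plans = {\<pi>. prob_space \<pi> \<and> sets \<pi> = sets (borel_of P) \<and>
      (\<forall>\<alpha>\<in>I. distr \<pi> (borel_of (product_topology X \<alpha>)) (\<lambda>x. restrict x \<alpha>) = \<mu> \<alpha>)}"

lemma finite_I: "finite I" using finite_UnionD I_cover finite_J by metis

lemma subset_J: "\<alpha> \<in> I \<Longrightarrow> \<alpha> \<subseteq> J" using I_cover by auto

lemma metrizable_product: "\<alpha> \<subseteq> J \<Longrightarrow> metrizable_space (product_topology X \<alpha>)"
  unfolding metrizable_space_product_topology
  using finite_subset[OF _ finite_J] polish Polish_imp_metrizable by (auto intro!: countable_finite)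

lemma continuous_map_restrict_product:
  assumes "\<alpha> \<subseteq> J"
  shows "continuous_map P (product_topology X \<alpha>) (\<lambda>x. restrict x \<alpha>)"
  unfolding continuous_map_componentwise
proof (intro conjI ballI)
  fix i assume i: "i \<in> \<alpha>"
  have "continuous_map P (X i) (\<lambda>x. x i)" by (rule continuous_map_product_projection) (use i assms in auto)
  then show "continuous_map P (X i) (\<lambda>x. restrict x \<alpha> i)" using i by simp
qed auto

lemma mu_finite: "\<alpha> \<in> I \<Longrightarrow> finite_measure (\<mu> \<alpha>)"
  using mu_prob prob_space.finite_measure by auto

lemma F_D:
  assumes "\<alpha> \<in> I" "f \<in> F \<alpha>"
  shows "continuous_map (product_topology X \<alpha>) euclideanreal f" "integrable (\<mu> \<alpha>) f"
  using F_CL[OF assms] by (auto simp: CL_def)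

lemma potD: "f \<in> pot \<Longrightarrow> \<alpha> \<in> I \<Longrightarrow> f \<alpha> \<in> F \<alpha>" by (auto simp: pot_def)

lemma F_const: "\<alpha> \<in> I \<Longrightarrow> (\<lambda>x. a) \<in> F \<alpha>" by (intro F_Cb Cb_const)

lemma pot_const: "(\<lambda>\<alpha> x. a) \<in> pot" by (auto simp: pot_def F_const)

lemma pot_add: "f \<in> pot \<Longrightarrow> g \<in> pot \<Longrightarrow> (\<lambda>\<alpha> x. f \<alpha> x + g \<alpha> x) \<in> pot"
  by (auto simp: pot_def F_add)

lemma pot_scale: "f \<in> pot \<Longrightarrow> (\<lambda>\<alpha> x. a * f \<alpha> x) \<in> pot"
  by (auto simp: pot_def F_scale)

text \<open>An absolute value is the sum of the cut-offs at 0 of f and of its negative. It provides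
  the growth bound that places \<open>tsum f\<close> in V.\<close>

lemma pot_abs:
  assumes f: "f \<in> pot" shows "(\<lambda>\<alpha> x. \<bar>f \<alpha> x\<bar>) \<in> pot"
  unfolding pot_def
proof (intro CollectI ballI)
  fix \<alpha> assume \<alpha>: "\<alpha> \<in> I"
  have "(\<lambda>x. max 0 (f \<alpha> x - 0) + max 0 (- 1 * f \<alpha> x - 0)) \<in> F \<alpha>"
    by (intro F_add F_cut F_scale \<alpha> potD[OF f])
  moreover have "(\<lambda>x. max 0 (f \<alpha> x - 0) + max 0 (- 1 * f \<alpha> x - 0)) = (\<lambda>x. \<bar>f \<alpha> x\<bar>)"
    by (auto simp: fun_eq_iff)
  ultimately show "(\<lambda>x. \<bar>f \<alpha> x\<bar>) \<in> F \<alpha>" by simp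
qed

lemma tsum_add: "tsum (\<lambda>\<alpha> x. f \<alpha> x + g \<alpha> x) x = tsum f x + tsum g x"
  by (simp add: tsum_def sum.distrib)

lemma tsum_scale: "tsum (\<lambda>\<alpha> x. a * f \<alpha> x) x = a * tsum f x"
  by (simp add: tsum_def sum_distrib_left)

lemma tint_add: "f \<in> pot \<Longrightarrow> g \<in> pot \<Longrightarrow> tint (\<lambda>\<alpha> x. f \<alpha> x + g \<alpha> x) = tint f + tint g"
  unfolding tint_def sum.distrib[symmetric]
  by (rule sum.cong) (auto intro!: Bochner_Integration.integral_add F_D potD)

lemma tint_scale: "tint (\<lambda>\<alpha> x. a * f \<alpha> x) = a * tint f"
  by (simp add: tint_def sum_distrib_left)

lemma continuous_map_tsum:
  assumes "f \<in> pot" shows "continuous_map P euclideanreal (tsum f)"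
  unfolding tsum_def
proof (rule continuous_map_sum[OF finite_I])
  fix \<alpha> assume \<alpha>: "\<alpha> \<in> I"
  show "continuous_map P euclideanreal (\<lambda>x. f \<alpha> (restrict x \<alpha>))"
    using continuous_map_compose[OF continuous_map_restrict_product[OF subset_J[OF \<alpha>]] F_D(1)[OF \<alpha> potD[OF assms \<alpha>]]]
    by (simp add: o_def)
qed

lemma V_subspace: "fun_subspace V"
  unfolding fun_subspace_def
proof (intro conjI ballI allI)
  show "(\<lambda>x. 0) \<in> V" unfolding V_def using pot_const[of 0] by (auto simp: tsum_def intro!: bexI[of _ "\<lambda>\<alpha> x. 0"])
next
  fix c c' assume "c \<in> V" "c' \<in> V"
  then obtain g g' where g: "continuous_map P euclideanreal c" "continuous_map P euclideanreal c'"
      "g \<in> pot" "g' \<in> pot" "\<forall>x\<in>topspace P. \<bar>c x\<bar> \<le> tsum g x" "\<forall>x\<in>topspace P. \<bar>c' x\<bar> \<le> tsum g' x"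
    unfolding V_def by blast
  have "\<forall>x\<in>topspace P. \<bar>c x + c' x\<bar> \<le> tsum (\<lambda>\<alpha> x. g \<alpha> x + g' \<alpha> x) x"
    unfolding tsum_add using g by (intro ballI order_trans[OF abs_triangle_ineq] add_mono) blast+
  then show "(\<lambda>x. c x + c' x) \<in> V" unfolding V_def
    using continuous_map_add[OF g(1,2)] pot_add[OF g(3,4)] by blast
next
  fix c a assume "c \<in> V"
  then obtain g where g: "continuous_map P euclideanreal c" "g \<in> pot" "\<forall>x\<in>topspace P. \<bar>c x\<bar> \<le> tsum g x"
    unfolding V_def by blast
  have "\<forall>x\<in>topspace P. \<bar>a * c x\<bar> \<le> tsum (\<lambda>\<alpha> x. \<bar>a\<bar> * g \<alpha> x) x"
    unfolding tsum_scale abs_mult using g by (intro ballI mult_left_mono) auto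
  then show "(\<lambda>x. a * c x) \<in> V" unfolding V_def
    using continuous_map_real_mult_left[OF g(1)] pot_scale[OF g(2)] by blast
qed

lemmas V_closed = fun_subspaceD[OF V_subspace]

lemma V_cont: "v \<in> V \<Longrightarrow> continuous_map P euclideanreal v" by (auto simp: V_def)

lemma Cb_subset_V: "Cb P \<subseteq> V"
proof
  fix c assume c: "c \<in> Cb P"
  then obtain B where B: "\<And>x. x \<in> topspace P \<Longrightarrow> \<bar>c x\<bar> \<le> B" unfolding Cb_def by blast
  have "\<bar>c x\<bar> \<le> tsum (\<lambda>\<alpha> x. \<bar>B\<bar>) x" if "x \<in> topspace P" for x
  proof -
    have "1 \<le> real (card I)" using I_nonempty finite_I by (simp add: Suc_le_eq card_gt_0_iff)
    then have "\<bar>B\<bar> \<le> real (card I) * \<bar>B\<bar>" by (simp add: mult_le_cancel_right1)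
    then show ?thesis using B[OF that] by (simp add: tsum_def)
  qed
  then show "c \<in> V" unfolding V_def using pot_const[of "\<bar>B\<bar>"] Cb_cont[OF c] by blast
qed

lemma tsum_in_V:
  assumes f: "f \<in> pot" shows "tsum f \<in> V"
proof -
  have "\<forall>x\<in>topspace P. \<bar>tsum f x\<bar> \<le> tsum (\<lambda>\<alpha> x. \<bar>f \<alpha> x\<bar>) x" unfolding tsum_def by (auto intro: sum_abs)
  then show ?thesis unfolding V_def using pot_abs[OF f] continuous_map_tsum[OF f] by blast
qed

lemma superhedges_nonempty: "v \<in> V \<Longrightarrow> superhedges v \<noteq> {}"
  unfolding superhedges_def V_def by (auto intro: order_trans[OF abs_ge_self])

lemma superhedges_add:
  "f \<in> superhedges v \<Longrightarrow> g \<in> superhedges w \<Longrightarrow>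
    (\<lambda>\<alpha> x. f \<alpha> x + g \<alpha> x) \<in> superhedges (\<lambda>x. v x + w x)"
  unfolding superhedges_def by (auto intro: pot_add simp: tsum_add intro!: add_mono)

text \<open>Adding one fixed superhedge of \<open>v - w\<close> turns every superhedge of w into one
  of v. So finiteness of the price at a single cost spreads to all of V.\<close>

lemma superhedges_bdd_below:
  assumes v: "v \<in> V" "bdd_below (tint ` superhedges v)" and w: "w \<in> V"
  shows "bdd_below (tint ` superhedges w)"
proof -
  obtain m where m: "\<And>f. f \<in> superhedges v \<Longrightarrow> m \<le> tint f" using v(2) by (auto simp: bdd_below_def)
  obtain h where h: "h \<in> superhedges (\<lambda>x. v x - w x)"
    using superhedges_nonempty[OF V_closed(5)[OF v(1) w]] by blast
  show ?thesis
  proof (rule bdd_belowI2[of _ "m - tint h"])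
    fix f assume f: "f \<in> superhedges w"
    have "m \<le> tint (\<lambda>\<alpha> x. h \<alpha> x + f \<alpha> x)" using m superhedges_add[OF h f] by simp
    also have "\<dots> = tint h + tint f" by (rule tint_add) (use f h in \<open>auto simp: superhedges_def\<close>)
    finally show "m - tint h \<le> tint f" by simp
  qed
qed

lemma sublinear_superhedging_price:
  assumes v: "v \<in> V" "bdd_below (tint ` superhedges v)"
  shows "sublinear_on V (\<lambda>c. INF f\<in>superhedges c. tint f)"
proof -
  define p where "p c = (INF f\<in>superhedges c. tint f)" for c
  have p_le: "p c \<le> tint f" if "c \<in> V" "f \<in> superhedges c" for c f
    unfolding p_def using superhedges_bdd_below[OF v that(1)] that(2) by (rule cINF_lower)
  have p_ge: "m \<le> p c" if "c \<in> V" "\<And>f. f \<in> superhedges c \<Longrightarrow> m \<le> tint f" for c m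
    unfolding p_def using superhedges_nonempty[OF that(1)] that(2) by (rule cINF_greatest)
  have "p (\<lambda>x. c x + c' x) \<le> p c + p c'" if c: "c \<in> V" "c' \<in> V" for c c'
  proof -
    have *: "p (\<lambda>x. c x + c' x) \<le> tint f + tint g" if "f \<in> superhedges c" "g \<in> superhedges c'" for f g
      using p_le[OF V_closed(2)[OF c] superhedges_add[OF that]] tint_add[of f g] that
      by (auto simp: superhedges_def)
    have "p (\<lambda>x. c x + c' x) - tint g \<le> p c" if "g \<in> superhedges c'" for g
      by (rule p_ge[OF c(1)]) (use *[OF _ that] in \<open>simp add: algebra_simps\<close>)
    then have "p (\<lambda>x. c x + c' x) - p c \<le> p c'"
      by (intro p_ge[OF c(2)]) (simp add: algebra_simps)
    then show ?thesis by simp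
  qed
  moreover have "p (\<lambda>x. a * c x) \<le> a * p c" if c: "c \<in> V" and a: "a > 0" for c a
  proof -
    have "p (\<lambda>x. a * c x) / a \<le> p c"
    proof (rule p_ge[OF c])
      fix f assume f: "f \<in> superhedges c"
      have "(\<lambda>\<alpha> x. a * f \<alpha> x) \<in> superhedges (\<lambda>x. a * c x)"
        using f a pot_scale by (auto simp: superhedges_def tsum_scale)
      then have "p (\<lambda>x. a * c x) \<le> a * tint f"
        using p_le[OF V_closed(3)[OF c]] by (fastforce simp: tint_scale)
      then show "p (\<lambda>x. a * c x) / a \<le> tint f" using a by (simp add: field_simps)
    qed
    then show ?thesis using a by (simp add: field_simps)
  qed
  ultimately show ?thesis unfolding sublinear_on_def p_def by blast
qed

lemma plans_integral:
  assumes \<pi>: "\<pi> \<in> plans" and f: "f \<in> pot"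
  shows "integrable \<pi> (tsum f)" "(\<integral>x. tsum f x \<partial>\<pi>) = tint f"
proof -
  have 1: "integrable \<pi> (\<lambda>x. f \<alpha> (restrict x \<alpha>)) \<and>
      (\<integral>x. f \<alpha> (restrict x \<alpha>) \<partial>\<pi>) = (\<integral>y. f \<alpha> y \<partial>\<mu> \<alpha>)" if \<alpha>: "\<alpha> \<in> I" for \<alpha>
  proof -
    let ?B = "borel_of (product_topology X \<alpha>)"
    have m: "(\<lambda>x. restrict x \<alpha>) \<in> \<pi> \<rightarrow>\<^sub>M ?B"
      using continuous_map_measurable_borel_of[OF continuous_map_restrict_product[OF subset_J[OF \<alpha>]]] \<pi>
      by (simp add: plans_def cong: measurable_cong_sets)
    have fm: "f \<alpha> \<in> borel_measurable ?B"
      by (rule continuous_map_borel_measurable[OF F_D(1)[OF \<alpha> potD[OF f \<alpha>]]]) simp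
    have d: "\<mu> \<alpha> = distr \<pi> ?B (\<lambda>x. restrict x \<alpha>)" using \<pi> \<alpha> by (auto simp: plans_def)
    show ?thesis
      using integrable_distr_eq[OF m fm] integral_distr[OF m fm] F_D(2)[OF \<alpha> potD[OF f \<alpha>]] d by simp
  qed
  show "integrable \<pi> (tsum f)" "(\<integral>x. tsum f x \<partial>\<pi>) = tint f"
    unfolding tsum_def tint_def using 1 by (auto simp: Bochner_Integration.integral_sum)
qed

lemma plans_integrable_V:
  assumes \<pi>: "\<pi> \<in> plans" and v: "v \<in> V"
  shows "integrable \<pi> v"
proof -
  obtain g where g: "g \<in> pot" "\<forall>x\<in>topspace P. \<bar>v x\<bar> \<le> tsum g x" using v unfolding V_def by blast
  have s: "sets \<pi> = sets (borel_of P)" using \<pi> by (simp add: plans_def)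
  show ?thesis
  proof (rule Bochner_Integration.integrable_bound[OF plans_integral(1)[OF \<pi> g(1)]])
    show "v \<in> borel_measurable \<pi>" by (rule continuous_map_borel_measurable[OF V_cont[OF v] s])
    show "AE x in \<pi>. norm (v x) \<le> norm (tsum g x)"
      using g(2) space_eq_topspace[OF s] by (auto intro!: AE_I2 intro: order_trans[OF _ abs_ge_self])
  qed
qed

end

section \<open>Functionals dominated by the superhedging price\<close>

locale multimarginal_functional = multimarginal X J I \<mu> F
  for X :: "'i \<Rightarrow> 'a topology" and J I \<mu> F +
  fixes L :: "(('i \<Rightarrow> 'a) \<Rightarrow> real) \<Rightarrow> real"
  assumes linear: "linear_fun_on V L"
    and le_tint: "\<And>v f. v \<in> V \<Longrightarrow> f \<in> superhedges v \<Longrightarrow> L v \<le> tint f"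
begin

lemmas L_linear = linear_fun_onD[OF linear]

text \<open>A potential superhedges its own sum exactly, and so does its negative; the two upper
  bounds pinch the value. This is how domination alone encodes the marginal constraints.\<close>

lemma L_tsum:
  assumes f: "f \<in> pot" shows "L (tsum f) = tint f"
proof (rule antisym)
  show "L (tsum f) \<le> tint f" by (rule le_tint[OF tsum_in_V[OF f]]) (use f in \<open>simp add: superhedges_def\<close>)
  have "L (\<lambda>x. - tsum f x) \<le> tint (\<lambda>\<alpha> x. - 1 * f \<alpha> x)"
  proof (rule le_tint)
    show "(\<lambda>x. - tsum f x) \<in> V" by (intro V_closed tsum_in_V f)
    show "(\<lambda>\<alpha> x. - 1 * f \<alpha> x) \<in> superhedges (\<lambda>x. - tsum f x)"
      using pot_scale[OF f, of "-1"] by (simp add: superhedges_def tsum_scale[of "-1", simplified])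
  qed
  then show "tint f \<le> L (tsum f)"
    using L_linear(3)[OF tsum_in_V[OF f]] by (simp add: tint_scale[of "-1", simplified])
qed

text \<open>If v is below w, the zero potential superhedges \<open>v - w\<close> at cost 0.\<close>

lemma L_mono:
  assumes "v \<in> V" "w \<in> V" "\<And>x. x \<in> topspace P \<Longrightarrow> v x \<le> w x"
  shows "L v \<le> L w"
proof -
  have "L (\<lambda>x. v x - w x) \<le> tint (\<lambda>\<alpha> x. 0)"
    by (rule le_tint) (use assms pot_const V_closed in \<open>auto simp: superhedges_def tsum_def\<close>)
  then show ?thesis using L_linear(4)[OF V_subspace assms(1,2)] by (simp add: tint_def)
qed

lemma L_marginal:
  assumes \<alpha>: "\<alpha> \<in> I" and f: "f \<in> F \<alpha>"
  shows "(\<lambda>x. f (restrict x \<alpha>)) \<in> V" "L (\<lambda>x. f (restrict x \<alpha>)) = (\<integral>y. f y \<partial>\<mu> \<alpha>)"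
proof -
  define h where "h \<beta> = (if \<beta> = \<alpha> then f else (\<lambda>x. 0))" for \<beta>
  have h: "h \<in> pot" using f by (auto simp: pot_def h_def F_const)
  have "tsum h x = f (restrict x \<alpha>)" for x
  proof -
    have "tsum h x = (\<Sum>\<beta>\<in>I. if \<beta> = \<alpha> then f (restrict x \<alpha>) else 0)"
      unfolding tsum_def by (rule sum.cong) (auto simp: h_def)
    then show ?thesis using \<alpha> finite_I by simp
  qed
  then have ts: "tsum h = (\<lambda>x. f (restrict x \<alpha>))" by auto
  have "tint h = (\<Sum>\<beta>\<in>I. if \<beta> = \<alpha> then \<integral>y. f y \<partial>\<mu> \<alpha> else 0)"
    unfolding tint_def by (rule sum.cong) (auto simp: h_def)
  then have ti: "tint h = (\<integral>y. f y \<partial>\<mu> \<alpha>)" using \<alpha> finite_I by simp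
  show "(\<lambda>x. f (restrict x \<alpha>)) \<in> V" using tsum_in_V[OF h] ts by simp
  show "L (\<lambda>x. f (restrict x \<alpha>)) = (\<integral>y. f y \<partial>\<mu> \<alpha>)" using L_tsum[OF h] ts ti by simp
qed

lemma L_const: "L (\<lambda>x. a) = a"
proof -
  obtain \<alpha> where \<alpha>: "\<alpha> \<in> I" using I_nonempty by auto
  interpret prob_space "\<mu> \<alpha>" by (rule mu_prob[OF \<alpha>])
  show ?thesis using L_marginal(2)[OF \<alpha> F_const[OF \<alpha>], of a] by (simp add: prob_space)
qed

text \<open>On functions of one coordinate L is integration against the image of some
  \<open>\<mu> \<alpha>\<close> with i in \<alpha>. Tightness of that image measure thus passes to L
  before L is known to come from a measure on the product.\<close>

lemma coordinate_tight:
  assumes i: "i \<in> J" and e: "e > 0"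
  obtains K where "compactin (X i) K"
    "\<And>\<phi>. continuous_map (X i) euclideanreal \<phi> \<Longrightarrow> (\<And>x. x \<in> topspace (X i) \<Longrightarrow> 0 \<le> \<phi> x \<and> \<phi> x \<le> 1) \<Longrightarrow>
      (\<And>x. x \<in> K \<Longrightarrow> \<phi> x = 0) \<Longrightarrow> (\<lambda>x. \<phi> (x i)) \<in> V \<and> L (\<lambda>x. \<phi> (x i)) \<le> e"
proof -
  obtain \<alpha> where \<alpha>: "\<alpha> \<in> I" "i \<in> \<alpha>" using i I_cover by auto
  interpret M: prob_space "\<mu> \<alpha>" by (rule mu_prob[OF \<alpha>(1)])
  have proj: "continuous_map (product_topology X \<alpha>) (X i) (\<lambda>y. y i)"
    by (rule continuous_map_product_projection[OF \<alpha>(2)])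
  have m: "(\<lambda>y. y i) \<in> \<mu> \<alpha> \<rightarrow>\<^sub>M borel_of (X i)"
    using continuous_map_measurable_borel_of[OF proj] mu_sets[OF \<alpha>(1)] by (simp cong: measurable_cong_sets)
  define \<nu> where "\<nu> = distr (\<mu> \<alpha>) (borel_of (X i)) (\<lambda>y. y i)"
  interpret N: prob_space \<nu> unfolding \<nu>_def by (rule M.prob_space_distr[OF m])
  have sN: "sets \<nu> = sets (borel_of (X i))" by (simp add: \<nu>_def)
  obtain K where K: "compactin (X i) K" "measure \<nu> (topspace (X i) - K) \<le> e"
    using Polish_tight[OF polish[OF i] N.finite_measure sN e] by blast
  have "Hausdorff_space (X i)"
    using metrizable_imp_Hausdorff_space Polish_imp_metrizable polish[OF i] by blast
  then have "closedin (X i) K" by (rule compactin_imp_closedin[OF _ K(1)])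
  then have open_K: "openin (X i) (topspace (X i) - K)" by (rule openin_diff[OF openin_topspace])
  show ?thesis
  proof (rule that[OF K(1)])
    fix \<phi> assume \<phi>: "continuous_map (X i) euclideanreal \<phi>"
      "\<And>x. x \<in> topspace (X i) \<Longrightarrow> 0 \<le> \<phi> x \<and> \<phi> x \<le> 1" "\<And>x. x \<in> K \<Longrightarrow> \<phi> x = 0"
    have "(\<lambda>y. \<phi> (y i)) \<in> Cb (product_topology X \<alpha>)"
      by (rule CbI[OF continuous_map_compose[OF proj \<phi>(1), unfolded o_def], where B=1])
        (use \<phi>(2) \<alpha> in \<open>auto simp: PiE_iff\<close>)
    then have f: "(\<lambda>y. \<phi> (y i)) \<in> F \<alpha>" by (rule F_Cb[OF \<alpha>(1)])
    have "L (\<lambda>x. \<phi> (x i)) = (\<integral>y. \<phi> (y i) \<partial>\<mu> \<alpha>)" using L_marginal(2)[OF \<alpha>(1) f] \<alpha>(2) by simp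
    also have "\<dots> = (\<integral>x. \<phi> x \<partial>\<nu>)"
      unfolding \<nu>_def by (rule integral_distr[OF m, symmetric]) (rule continuous_map_borel_measurable[OF \<phi>(1) refl])
    also have "\<dots> \<le> (\<integral>x. indicator (topspace (X i) - K) x \<partial>\<nu>)"
    proof (rule integral_mono)
      show "integrable \<nu> \<phi>" by (rule integrable_Cb[OF N.finite_measure sN CbI[OF \<phi>(1), where B=1]]) (use \<phi>(2) in auto)
      show "integrable \<nu> (\<lambda>x. indicator (topspace (X i) - K) x :: real)"
        using openin_borel_of[OF open_K] sN by (simp add: N.emeasure_eq_measure)
      show "\<phi> x \<le> indicator (topspace (X i) - K) x" if "x \<in> space \<nu>" for x
        using that \<phi> space_eq_topspace[OF sN] by (auto simp: indicator_def)
    qed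
    also have "\<dots> = measure \<nu> (topspace (X i) - K)" using openin_borel_of[OF open_K] sN by simp
    also have "\<dots> \<le> e" by (rule K(2))
    finally show "(\<lambda>x. \<phi> (x i)) \<in> V \<and> L (\<lambda>x. \<phi> (x i)) \<le> e" using L_marginal(1)[OF \<alpha>(1) f] \<alpha>(2) by simp
  qed
qed

lemma L_Daniell_continuous:
  assumes c: "\<And>j. c j \<in> Cb P" and c0: "\<And>j x. x \<in> topspace P \<Longrightarrow> 0 \<le> c j x"
    and c_dec: "\<And>j x. x \<in> topspace P \<Longrightarrow> c (Suc j) x \<le> c j x"
    and c_lim: "\<And>x. x \<in> topspace P \<Longrightarrow> (\<lambda>j. c j x) \<longlonglongrightarrow> 0"
  shows "(\<lambda>j. L (c j)) \<longlonglongrightarrow> 0"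
proof -
  have cV: "c j \<in> V" for j using c Cb_subset_V by auto
  have dec: "c k x \<le> c j x" if "x \<in> topspace P" "j \<le> k" for j k x
    using that(2) by (rule lift_Suc_antimono_le[rotated]) (use c_dec that in auto)
  have L0: "0 \<le> L (c j)" for j using L_mono[OF V_closed(1) cV, of j] c0 L_const by auto
  obtain B0 where B0: "\<And>x. x \<in> topspace P \<Longrightarrow> \<bar>c 0 x\<bar> \<le> B0" using c[of 0] unfolding Cb_def by blast
  define B where "B = max 1 B0"
  have B: "B > 0" "\<And>x. x \<in> topspace P \<Longrightarrow> c 0 x \<le> B" using B0 by (force simp: B_def)+
  have small: "\<exists>k. \<forall>j\<ge>k. L (c j) \<le> e + e" if e: "e > 0" for e :: real
  proof -
    \<comment> \<open>All coordinates together then cost at most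
      \<open>B * card J * \<delta> \<le> e\<close>; the added 1 keeps the divisor positive for empty
      J.\<close>
    define \<delta> where "\<delta> = e / (B * (real (card J) + 1))"
    have \<delta>: "\<delta> > 0" using e B by (simp add: \<delta>_def add_nonneg_pos)
    have "\<exists>K. compactin (X i) K \<and> (\<forall>\<phi>. continuous_map (X i) euclideanreal \<phi> \<longrightarrow>
        (\<forall>x\<in>topspace (X i). 0 \<le> \<phi> x \<and> \<phi> x \<le> 1) \<longrightarrow> (\<forall>x\<in>K. \<phi> x = 0) \<longrightarrow>
        (\<lambda>x. \<phi> (x i)) \<in> V \<and> L (\<lambda>x. \<phi> (x i)) \<le> \<delta>)" if "i \<in> J" for i
      using coordinate_tight[OF that \<delta>] by metis
    then obtain K where K: "\<And>i. i \<in> J \<Longrightarrow> compactin (X i) (K i)"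
      and K\<phi>: "\<And>i \<phi>. i \<in> J \<Longrightarrow> continuous_map (X i) euclideanreal \<phi> \<Longrightarrow>
        (\<forall>x\<in>topspace (X i). 0 \<le> \<phi> x \<and> \<phi> x \<le> 1) \<Longrightarrow> (\<forall>x\<in>K i. \<phi> x = 0) \<Longrightarrow>
        (\<lambda>x. \<phi> (x i)) \<in> V \<and> L (\<lambda>x. \<phi> (x i)) \<le> \<delta>"
      by metis
    have "\<exists>\<phi> k. (\<forall>i\<in>J. continuous_map (X i) euclideanreal (\<phi> i) \<and>
        (\<forall>x\<in>topspace (X i). 0 \<le> \<phi> i x \<and> \<phi> i x \<le> (1::real)) \<and> (\<forall>x\<in>K i. \<phi> i x = 0)) \<and>
        (\<forall>x\<in>topspace P. c k x < e \<or> (\<exists>i\<in>J. \<phi> i (x i) = 1))"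
      by (rule product_Dini[OF finite_J Polish_imp_metrizable[OF polish] K Cb_cont[OF c] c_dec c_lim e])
    then obtain \<phi> k where \<phi>: "\<forall>i\<in>J. continuous_map (X i) euclideanreal (\<phi> i) \<and>
        (\<forall>x\<in>topspace (X i). 0 \<le> \<phi> i x \<and> \<phi> i x \<le> (1::real)) \<and> (\<forall>x\<in>K i. \<phi> i x = 0)"
      and k\<phi>: "\<And>x. x \<in> topspace P \<Longrightarrow> c k x < e \<or> (\<exists>i\<in>J. \<phi> i (x i) = 1)"
      by blast
    note \<phi>01 = \<phi>[rule_format, THEN conjunct2, THEN conjunct1, rule_format]
    have \<phi>L: "(\<lambda>x. \<phi> i (x i)) \<in> V" "L (\<lambda>x. \<phi> i (x i)) \<le> \<delta>" if "i \<in> J" for i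
      using K\<phi>[OF that] \<phi> that by blast+
    note sumL = linear_fun_on_sum[OF V_subspace linear finite_J \<phi>L(1)]
    have eV: "(\<lambda>x. e) \<in> V" using Cb_const Cb_subset_V by auto
    \<comment> \<open>Where \<open>c k\<close> is not below e, some cut-off equals 1, and the factor
      B covers \<open>c k \<le> c 0 \<le> B\<close>.\<close>
    have "L (c k) \<le> L (\<lambda>x. e + B * (\<Sum>i\<in>J. \<phi> i (x i)))"
    proof (rule L_mono[OF cV V_closed(2)[OF eV V_closed(3)[OF sumL(1)]]])
      fix x assume x: "x \<in> topspace P"
      have x\<phi>: "0 \<le> \<phi> i (x i)" if "i \<in> J" for i using \<phi>01[OF that] x that by (auto simp: PiE_iff)
      show "c k x \<le> e + B * (\<Sum>i\<in>J. \<phi> i (x i))"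
      proof (cases "c k x < e")
        case True
        moreover have "0 \<le> B * (\<Sum>i\<in>J. \<phi> i (x i))" using B(1) x\<phi> by (simp add: sum_nonneg)
        ultimately show ?thesis by simp
      next
        case False
        then obtain i where i: "i \<in> J" "\<phi> i (x i) = 1" using k\<phi>[OF x] by auto
        have "\<phi> i (x i) \<le> (\<Sum>i\<in>J. \<phi> i (x i))" by (rule member_le_sum[OF i(1)]) (use x\<phi> finite_J in auto)
        then have "B * 1 \<le> B * (\<Sum>i\<in>J. \<phi> i (x i))" using B(1) i(2) by (intro mult_left_mono) auto
        then show ?thesis using B(2)[OF x] dec[OF x, of 0 k] e by simp
      qed
    qed
    also have "\<dots> = e + B * (\<Sum>i\<in>J. L (\<lambda>x. \<phi> i (x i)))"
      using L_linear(1)[OF eV V_closed(3)[OF sumL(1)]] L_linear(2)[OF sumL(1)] sumL(2) L_const by simp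
    also have "(\<Sum>i\<in>J. L (\<lambda>x. \<phi> i (x i))) \<le> real (card J) * \<delta>"
      using sum_bounded_above[of J "\<lambda>i. L (\<lambda>x. \<phi> i (x i))" \<delta>] \<phi>L(2) by simp
    also have "B * (real (card J) * \<delta>) \<le> e"
    proof -
      have "B * (real (card J) * \<delta>) \<le> B * ((real (card J) + 1) * \<delta>)"
        using B(1) \<delta> by (intro mult_left_mono mult_right_mono) auto
      also have "\<dots> = e" using B(1) by (simp add: \<delta>_def add_nonneg_eq_0_iff)
      finally show ?thesis .
    qed
    finally have "L (c k) \<le> e + e" using B(1) by simp
    moreover have "L (c j) \<le> L (c k)" if "j \<ge> k" for j
      by (rule L_mono[OF cV cV]) (rule dec[OF _ that])
    ultimately show ?thesis by (intro exI[of _ k]) (auto intro: order_trans)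
  qed
  show ?thesis
  proof (rule LIMSEQ_I)
    fix r :: real assume r: "r > 0"
    obtain k where k: "\<And>j. j \<ge> k \<Longrightarrow> L (c j) \<le> r/3 + r/3" using small[of "r/3"] r by auto
    have "norm (L (c j) - 0) < r" if "j \<ge> k" for j using k[OF that] L0[of j] r by simp
    then show "\<exists>k. \<forall>j\<ge>k. norm (L (c j) - 0) < r" by blast
  qed
qed

sublocale D: Daniell_functional P L
proof
  show "metrizable_space P" by (rule metrizable_product) simp
  show "linear_fun_on (Cb P) L"
    using linear Cb_subset_V by (auto simp: linear_fun_on_def subset_iff)
  show "L f \<le> L g" if "f \<in> Cb P" "g \<in> Cb P" "\<And>x. x \<in> topspace P \<Longrightarrow> f x \<le> g x" for f g
    using L_mono that Cb_subset_V by auto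
  show "(\<lambda>j. L (f j)) \<longlonglongrightarrow> 0" if "\<And>j. f j \<in> Cb P" "\<And>j x. x \<in> topspace P \<Longrightarrow> 0 \<le> f j x"
    "\<And>j x. x \<in> topspace P \<Longrightarrow> f (Suc j) x \<le> f j x" "\<And>x. x \<in> topspace P \<Longrightarrow> (\<lambda>j. f j x) \<longlonglongrightarrow> 0" for f
    by (rule L_Daniell_continuous) (use that in auto)
qed

text \<open>A bounded continuous function on \<open>X_\<alpha>\<close> is an admissible potential,
  so L, and with it the measure, integrates its lift as \<open>\<mu> \<alpha>\<close> does; such
  integrals determine a finite Borel measure.\<close>

lemma Daniell_measure_in_plans: "D.\<pi> \<in> plans"
  unfolding plans_def
proof (intro CollectI conjI ballI)
  interpret D\<pi>: finite_measure D.\<pi> by (rule D.finite_measure_\<pi>)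
  show "sets D.\<pi> = sets (borel_of P)" by (rule D.sets_\<pi>)
  show "prob_space D.\<pi>"
  proof
    show "emeasure D.\<pi> (space D.\<pi>) = 1"
      using D.measure_\<pi>_topspace L_const[of 1] by (simp add: D\<pi>.emeasure_eq_measure D.space_\<pi>)
  qed
  then interpret D\<pi>: prob_space D.\<pi> .
  fix \<alpha> assume \<alpha>: "\<alpha> \<in> I"
  let ?B = "borel_of (product_topology X \<alpha>)"
  have m: "(\<lambda>x. restrict x \<alpha>) \<in> D.\<pi> \<rightarrow>\<^sub>M ?B"
    using continuous_map_measurable_borel_of[OF continuous_map_restrict_product[OF subset_J[OF \<alpha>]]] D.sets_\<pi>
    by (simp cong: measurable_cong_sets)
  show "distr D.\<pi> ?B (\<lambda>x. restrict x \<alpha>) = \<mu> \<alpha>"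
  proof (rule finite_borel_measure_eqI[OF metrizable_product[OF subset_J[OF \<alpha>]] _ _ mu_finite[OF \<alpha>] mu_sets[OF \<alpha>]])
    show "finite_measure (distr D.\<pi> ?B (\<lambda>x. restrict x \<alpha>))" by (rule D\<pi>.finite_measure_distr[OF m])
    fix f assume f: "f \<in> Cb (product_topology X \<alpha>)"
    have "(\<lambda>x. f (restrict x \<alpha>)) \<in> Cb P"
    proof -
      obtain B where B: "\<And>y. y \<in> topspace (product_topology X \<alpha>) \<Longrightarrow> \<bar>f y\<bar> \<le> B"
        using f unfolding Cb_def by blast
      show ?thesis
      proof (rule CbI)
        show "continuous_map P euclideanreal (\<lambda>x. f (restrict x \<alpha>))"
          using continuous_map_compose[OF continuous_map_restrict_product[OF subset_J[OF \<alpha>]] Cb_cont[OF f]]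
          by (simp add: o_def)
        fix x assume "x \<in> topspace P"
        then have "restrict x \<alpha> \<in> topspace (product_topology X \<alpha>)"
          using continuous_map_restrict_product[OF subset_J[OF \<alpha>]] unfolding continuous_map_def
          by (blast dest: Pi_mem)
        then show "\<bar>f (restrict x \<alpha>)\<bar> \<le> B" by (rule B)
      qed
    qed
    then have "(\<integral>x. f (restrict x \<alpha>) \<partial>D.\<pi>) = (\<integral>y. f y \<partial>\<mu> \<alpha>)"
      using D.integral_eq_L L_marginal(2)[OF \<alpha> F_Cb[OF \<alpha> f]] by simp
    then show "(\<integral>x. f x \<partial>distr D.\<pi> ?B (\<lambda>x. restrict x \<alpha>)) = (\<integral>y. f y \<partial>\<mu> \<alpha>)"
      using integral_distr[OF m continuous_map_borel_measurable[OF Cb_cont[OF f] refl]] by simp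
  qed simp
qed

text \<open>Representation is known only for bounded functions. Truncating v to the range from -m to
  m changes it by at most \<open>tsum (h m)\<close>, which bounds both the change of L and the
  change of the integral by \<open>tint (h m)\<close>; hence the factor 2. Dominated convergence
  makes this error vanish.\<close>

lemma integral_eq_L_V:
  assumes v: "v \<in> V"
  shows "(\<integral>x. v x \<partial>D.\<pi>) = L v"
proof -
  note \<pi> = Daniell_measure_in_plans
  obtain g where g: "g \<in> pot" "\<And>x. x \<in> topspace P \<Longrightarrow> \<bar>v x\<bar> \<le> tsum g x" using v unfolding V_def by blast
  define N where "N = real (card I)"
  have N: "N > 0" unfolding N_def using I_nonempty finite_I by (simp add: card_gt_0_iff)
  \<comment> \<open>The level m is shared equally among the N potentials, so the sum of the excesses
    over \<open>m / N\<close> is at least the excess of \<open>tsum g\<close> over m.\<close>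
  define h where "h m \<alpha> x = max 0 (g \<alpha> x - real m / N)" for m :: nat and \<alpha> x
  have h: "h m \<in> pot" for m
    unfolding pot_def h_def by (intro CollectI ballI F_cut potD[OF g(1)])
  have le: "\<bar>L v - (\<integral>x. v x \<partial>D.\<pi>)\<bar> \<le> 2 * tint (h m)" for m
  proof -
    define w where "w x = max (- real m) (min (real m) (v x))" for x
    have "w \<in> Cb P" unfolding w_def
    proof (rule CbI)
      show "continuous_map P euclideanreal (\<lambda>x. max (- real m) (min (real m) (v x)))"
        by (intro continuous_map_real_max continuous_map_real_min V_cont[OF v]) auto
      show "\<bar>max (- real m) (min (real m) (v y))\<bar> \<le> real m" for y by auto
    qed
    then have w: "w \<in> V" "(\<integral>x. w x \<partial>D.\<pi>) = L w" using Cb_subset_V D.integral_eq_L by auto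
    have bnd: "\<bar>v x - w x\<bar> \<le> tsum (h m) x" if x: "x \<in> topspace P" for x
    proof -
      have "tsum g x - real m = (\<Sum>\<alpha>\<in>I. g \<alpha> (restrict x \<alpha>) - real m / N)"
        using N by (simp add: tsum_def sum_subtractf N_def)
      also have "\<dots> \<le> tsum (h m) x" unfolding tsum_def h_def by (rule sum_mono) simp
      finally have 1: "\<bar>v x\<bar> - real m \<le> tsum (h m) x" using g(2)[OF x] by simp
      have "0 \<le> tsum (h m) x" unfolding tsum_def h_def by (rule sum_nonneg) simp
      then show ?thesis using 1 by (auto simp: w_def min_def max_def abs_if split: if_splits)
    qed
    \<comment> \<open>\<open>h m\<close> superhedges \<open>v - w\<close> as well as
      \<open>w - v\<close>, so the bound on L uses domination in both directions.\<close>
    have d1: "L v - L w \<le> tint (h m)"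
      using le_tint[OF V_closed(5)[OF v w(1)], of "h m"] bnd h L_linear(4)[OF V_subspace v w(1)]
      by (force simp: superhedges_def)
    have d2: "L w - L v \<le> tint (h m)"
      using le_tint[OF V_closed(5)[OF w(1) v], of "h m"] bnd h L_linear(4)[OF V_subspace w(1) v]
      by (force simp: superhedges_def)
    have iv: "integrable D.\<pi> v" and iw: "integrable D.\<pi> w" by (rule plans_integrable_V[OF \<pi>], fact v w)+
    have "\<bar>(\<integral>x. v x \<partial>D.\<pi>) - (\<integral>x. w x \<partial>D.\<pi>)\<bar> = \<bar>\<integral>x. v x - w x \<partial>D.\<pi>\<bar>" using iv iw by simp
    also have "\<dots> \<le> (\<integral>x. \<bar>v x - w x\<bar> \<partial>D.\<pi>)" by (rule integral_abs_bound)
    also have "\<dots> \<le> (\<integral>x. tsum (h m) x \<partial>D.\<pi>)"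
      by (rule integral_mono) (use iv iw plans_integral(1)[OF \<pi> h] bnd D.space_\<pi> in auto)
    also have "\<dots> = tint (h m)" by (rule plans_integral(2)[OF \<pi> h])
    finally show ?thesis using d1 d2 w(2) by linarith
  qed
  have "(\<lambda>m. tint (h m)) \<longlonglongrightarrow> (\<Sum>\<alpha>\<in>I. 0)"
    unfolding tint_def
  proof (rule tendsto_sum)
    fix \<alpha> assume \<alpha>: "\<alpha> \<in> I"
    have "(\<lambda>m. \<integral>y. h m \<alpha> y \<partial>\<mu> \<alpha>) \<longlonglongrightarrow> (\<integral>y. 0 \<partial>\<mu> \<alpha>)"
    proof (rule integral_dominated_convergence[where w="\<lambda>y. \<bar>g \<alpha> y\<bar>"])
      show "integrable (\<mu> \<alpha>) (\<lambda>y. \<bar>g \<alpha> y\<bar>)" using F_D(2)[OF \<alpha> potD[OF g(1) \<alpha>]] by simp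
      show "h m \<alpha> \<in> borel_measurable (\<mu> \<alpha>)" for m using F_D(2)[OF \<alpha> potD[OF h \<alpha>]] by auto
      show "AE y in \<mu> \<alpha>. (\<lambda>m. h m \<alpha> y) \<longlonglongrightarrow> 0"
      proof (rule AE_I2)
        fix y
        obtain k :: nat where k: "N * g \<alpha> y \<le> real k" using real_arch_simple by blast
        have "\<forall>\<^sub>F m in sequentially. h m \<alpha> y = 0"
        proof (rule eventually_sequentiallyI[of k])
          fix m assume "k \<le> m"
          then have "N * g \<alpha> y \<le> real m" using k by linarith
          then show "h m \<alpha> y = 0" using N by (simp add: h_def field_simps)
        qed
        then show "(\<lambda>m. h m \<alpha> y) \<longlonglongrightarrow> 0" by (rule tendsto_eventually)
      qed
      show "AE y in \<mu> \<alpha>. norm (h m \<alpha> y) \<le> \<bar>g \<alpha> y\<bar>" for m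
      proof (rule AE_I2)
        fix y
        have "0 \<le> real m / N" using N by simp
        then show "norm (h m \<alpha> y) \<le> \<bar>g \<alpha> y\<bar>" unfolding h_def by simp
      qed
    qed simp
    then show "(\<lambda>m. \<integral>y. h m \<alpha> y \<partial>\<mu> \<alpha>) \<longlonglongrightarrow> 0" by simp
  qed
  then have "(\<lambda>m. 2 * tint (h m)) \<longlonglongrightarrow> 2 * 0" by (intro tendsto_mult tendsto_const) simp
  then have "\<bar>L v - (\<integral>x. v x \<partial>D.\<pi>)\<bar> \<le> 2 * 0"
    by (rule LIMSEQ_le_const) (use le in auto)
  then show ?thesis by simp
qed

end

section \<open>Strong duality and attainment\<close>

context multimarginal
begin

text \<open>Existence of a plan is part of the conclusion: boundedness below of the price already
  yields a functional, and its measure attains the price at v.\<close>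

lemma superhedging_attained:
  assumes v: "v \<in> V" and bdd: "bdd_below (tint ` superhedges v)"
  shows "\<exists>\<pi>\<in>plans. (\<integral>x. v x \<partial>\<pi>) = (INF f\<in>superhedges v. tint f)"
proof -
  obtain L where L: "linear_fun_on V L" "\<And>w. w \<in> V \<Longrightarrow> L w \<le> (INF f\<in>superhedges w. tint f)"
    "L v = (INF f\<in>superhedges v. tint f)"
    using Hahn_Banach_attained[OF V_subspace sublinear_superhedging_price[OF v bdd] v] by blast
  interpret multimarginal_functional X J I \<mu> F L
  proof
    show "linear_fun_on V L" by (rule L(1))
    fix w f assume "w \<in> V" "f \<in> superhedges w"
    then show "L w \<le> tint f"
      using L(2)[of w] cINF_lower[OF superhedges_bdd_below[OF v bdd], of w f] by simp
  qed
  show ?thesis using Daniell_measure_in_plans integral_eq_L_V[OF v] L(3) by auto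
qed

lemma weak_duality:
  assumes \<pi>: "\<pi> \<in> plans" and c: "c \<in> V" and f: "f \<in> pot" "\<And>x. x \<in> topspace P \<Longrightarrow> tsum f x \<le> c x"
  shows "tint f \<le> (\<integral>x. c x \<partial>\<pi>)"
proof -
  have "space \<pi> = topspace P" using \<pi> by (intro space_eq_topspace) (simp add: plans_def)
  then have "(\<integral>x. tsum f x \<partial>\<pi>) \<le> (\<integral>x. c x \<partial>\<pi>)"
    by (intro integral_mono plans_integral(1)[OF \<pi> f(1)] plans_integrable_V[OF \<pi> c]) (use f(2) in auto)
  then show ?thesis using plans_integral(2)[OF \<pi> f(1)] by simp
qed

theorem Kantorovich_duality:
  assumes c: "c \<in> V"
  defines "D \<equiv> {f\<in>pot. \<forall>x\<in>topspace P. tsum f x \<le> c x}"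
  shows "(INF \<pi>\<in>plans. ereal (\<integral>x. c x \<partial>\<pi>)) = (SUP f\<in>D. ereal (tint f))"
    and "plans \<noteq> {} \<Longrightarrow> \<exists>\<pi>\<in>plans. ereal (\<integral>x. c x \<partial>\<pi>) = (INF \<pi>\<in>plans. ereal (\<integral>x. c x \<partial>\<pi>))"
proof -
  have weak: "(SUP f\<in>D. ereal (tint f)) \<le> (INF \<pi>\<in>plans. ereal (\<integral>x. c x \<partial>\<pi>))"
    by (intro SUP_least INF_greatest) (use weak_duality[OF _ c] in \<open>auto simp: D_def\<close>)
  \<comment> \<open>Negating potentials exchanges subhedges of c with superhedges of
    \<open>-c\<close>, so the dual supremum is minus a price.\<close>
  have neg: "(\<lambda>\<alpha> x. - 1 * f \<alpha> x) \<in> D \<longleftrightarrow> f \<in> superhedges (\<lambda>x. - c x)"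
    if "f \<in> pot" for f
    unfolding D_def superhedges_def mem_Collect_eq tsum_scale using pot_scale[OF that, of "-1"] that by auto
  have "(INF \<pi>\<in>plans. ereal (\<integral>x. c x \<partial>\<pi>)) = (SUP f\<in>D. ereal (tint f)) \<and>
     (plans \<noteq> {} \<longrightarrow> (\<exists>\<pi>\<in>plans. ereal (\<integral>x. c x \<partial>\<pi>) = (INF \<pi>\<in>plans. ereal (\<integral>x. c x \<partial>\<pi>))))"
  proof (cases "bdd_above (tint ` D)")
    case True
    then obtain m where m: "\<And>f. f \<in> D \<Longrightarrow> tint f \<le> m" by (auto simp: bdd_above_def)
    have cV: "(\<lambda>x. - c x) \<in> V" by (rule V_closed(4)[OF c])
    let ?S = "superhedges (\<lambda>x. - c x)"
    have SD: "(\<lambda>\<alpha> x. - 1 * f \<alpha> x) \<in> D" if "f \<in> ?S" for f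
      using neg that unfolding superhedges_def by blast
    have bdd: "bdd_below (tint ` ?S)"
    proof (rule bdd_belowI2[of _ "- m"])
      fix f assume "f \<in> ?S"
      then have "tint (\<lambda>\<alpha> x. - 1 * f \<alpha> x) \<le> m" by (intro m SD)
      then show "- m \<le> tint f" unfolding tint_scale by simp
    qed
    obtain \<pi> where \<pi>: "\<pi> \<in> plans" "(\<integral>x. - c x \<partial>\<pi>) = (INF f\<in>?S. tint f)"
      using superhedging_attained[OF cV bdd] by blast
    have "ereal (\<integral>x. c x \<partial>\<pi>) \<le> (SUP f\<in>D. ereal (tint f))"
    proof (rule ereal_le_epsilon2)
      fix e :: real assume "0 < e"
      then have "(INF f\<in>?S. tint f) < (INF f\<in>?S. tint f) + e" by simp
      then obtain f where f: "f \<in> ?S" "tint f < (INF f\<in>?S. tint f) + e"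
        using cINF_less_iff[OF superhedges_nonempty[OF cV] bdd] by blast
      have "(\<integral>x. c x \<partial>\<pi>) \<le> tint (\<lambda>\<alpha> x. - 1 * f \<alpha> x) + e" using f(2) \<pi>(2) unfolding tint_scale by simp
      then have "ereal (\<integral>x. c x \<partial>\<pi>) \<le> ereal (tint (\<lambda>\<alpha> x. - 1 * f \<alpha> x)) + ereal e" by simp
      also have "\<dots> \<le> (SUP f\<in>D. ereal (tint f)) + ereal e"
        by (rule add_right_mono, rule SUP_upper, rule SD[OF f(1)])
      finally show "ereal (\<integral>x. c x \<partial>\<pi>) \<le> (SUP f\<in>D. ereal (tint f)) + ereal e" .
    qed
    moreover have "(INF \<pi>\<in>plans. ereal (\<integral>x. c x \<partial>\<pi>)) \<le> ereal (\<integral>x. c x \<partial>\<pi>)" by (rule INF_lower[OF \<pi>(1)])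
    ultimately show ?thesis using weak \<pi>(1) by (meson antisym order_trans)
  next
    \<comment> \<open>By weak duality any plan would bound all dual values, so none exists, and the
      infimum over the empty set matches the infinite supremum.\<close>
    case False
    have "(SUP f\<in>D. ereal (tint f)) = \<infinity>"
    proof (rule SUP_PInfty)
      fix n :: nat
      show "\<exists>f\<in>D. ereal (real n) \<le> ereal (tint f)"
        using False by (auto simp: bdd_above_def not_le intro: less_imp_le)
    qed
    moreover have "plans = {}"
    proof (rule ccontr)
      assume "plans \<noteq> {}"
      then obtain \<pi> where \<pi>: "\<pi> \<in> plans" by auto
      have "bdd_above (tint ` D)"
        by (rule bdd_aboveI2[of _ _ "\<integral>x. c x \<partial>\<pi>"]) (use weak_duality[OF \<pi> c] in \<open>auto simp: D_def\<close>)
      then show False using False by simp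
    qed
    ultimately show ?thesis by (simp add: top_ereal_def)
  qed
  then show "(INF \<pi>\<in>plans. ereal (\<integral>x. c x \<partial>\<pi>)) = (SUP f\<in>D. ereal (tint f))"
    "plans \<noteq> {} \<Longrightarrow> \<exists>\<pi>\<in>plans. ereal (\<integral>x. c x \<partial>\<pi>) = (INF \<pi>\<in>plans. ereal (\<integral>x. c x \<partial>\<pi>))" by auto
qed

end

section \<open>Instances for integrable and for bounded potentials\<close>

lemma CL_cut:
  assumes "prob_space m" "f \<in> CL Y m"
  shows "(\<lambda>x. max 0 (f x - t)) \<in> CL Y m"
proof -
  interpret prob_space m by fact
  have "integrable m (\<lambda>x. max 0 (f x - t))"
    using assms(2) by (intro integrable_max) (auto simp: CL_def)
  then show ?thesis using assms(2)
    by (auto simp: CL_def intro!: continuous_map_real_max continuous_map_diff)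
qed

theorem mainTheorem7:
  fixes X :: "nat \<Rightarrow> 'a topology" and n k :: nat
    and \<mu> :: "nat set \<Rightarrow> (nat \<Rightarrow> 'a) measure"
  assumes polish: "\<And>i. i \<in> {1..n} \<Longrightarrow> Polish_space (X i)"
    and k: "1 \<le> k" "k < n"
    and mu_prob: "\<And>\<alpha>. \<alpha> \<in> Inks n k \<Longrightarrow> prob_space (\<mu> \<alpha>)"
    and mu_sets: "\<And>\<alpha>. \<alpha> \<in> Inks n k \<Longrightarrow> sets (\<mu> \<alpha>) = sets (borel_of (Xsub X \<alpha>))"
  shows
    "(\<forall>c\<in>CLX X n k \<mu>.
        primal X n k \<mu> c = dual X n k \<mu> (\<lambda>\<alpha>. CL (Xsub X \<alpha>) (\<mu> \<alpha>)) c \<and>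
        (Marg X n k \<mu> \<noteq> {} \<longrightarrow>
           (\<exists>\<pi>\<in>Marg X n k \<mu>. ereal (\<integral>x. c x \<partial>\<pi>) = primal X n k \<mu> c)))
     \<and>
     (\<forall>c\<in>Cb (Xsub X {1..n}).
        primal X n k \<mu> c = dual X n k \<mu> (\<lambda>\<alpha>. Cb (Xsub X \<alpha>)) c \<and>
        (Marg X n k \<mu> \<noteq> {} \<longrightarrow>
           (\<exists>\<pi>\<in>Marg X n k \<mu>. ereal (\<integral>x. c x \<partial>\<pi>) = primal X n k \<mu> c)))"
proof -
  have cover: "\<Union>(Inks n k) = {1..n}"
  proof
    show "{1..n} \<subseteq> \<Union>(Inks n k)"
    proof
      fix i assume i: "i \<in> {1..n}"
      \<comment> \<open>Any i lies in a k-element set: complete it by k - 1 other indices.\<close>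
      have "k - 1 \<le> card ({1..n} - {i})" using i k by simp
      then obtain \<beta> where \<beta>: "\<beta> \<subseteq> {1..n} - {i}" "card \<beta> = k - 1" "finite \<beta>"
        by (rule obtain_subset_with_card_n)
      have "card (insert i \<beta>) = k" using \<beta> k by (subst card_insert_disjoint) auto
      then have "insert i \<beta> \<in> Inks n k" using \<beta> i by (auto simp: Inks_def)
      then show "i \<in> \<Union>(Inks n k)" by auto
    qed
  qed (auto simp: Inks_def)
  then have ne: "Inks n k \<noteq> {}" using k by auto
  have Cb_CL: "f \<in> CL (Xsub X \<alpha>) (\<mu> \<alpha>)" if "\<alpha> \<in> Inks n k" "f \<in> Cb (Xsub X \<alpha>)" for \<alpha> f
    using integrable_Cb[OF prob_space.finite_measure[OF mu_prob] mu_sets] that Cb_cont[OF that(2)]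
    by (auto simp: CL_def)
  interpret A: multimarginal X "{1..n}" "Inks n k" \<mu> "\<lambda>\<alpha>. CL (Xsub X \<alpha>) (\<mu> \<alpha>)"
  proof (rule multimarginal.intro)
    fix \<alpha> f g assume \<alpha>: "\<alpha> \<in> Inks n k" and f: "f \<in> CL (Xsub X \<alpha>) (\<mu> \<alpha>)" and g: "g \<in> CL (Xsub X \<alpha>) (\<mu> \<alpha>)"
    show "(\<lambda>x. f x + g x) \<in> CL (Xsub X \<alpha>) (\<mu> \<alpha>)"
      using f g by (auto simp: CL_def intro: continuous_map_add)
  next
    fix \<alpha> f a assume \<alpha>: "\<alpha> \<in> Inks n k" and f: "f \<in> CL (Xsub X \<alpha>) (\<mu> \<alpha>)"
    show "(\<lambda>x. a * f x) \<in> CL (Xsub X \<alpha>) (\<mu> \<alpha>)"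
      using f by (auto simp: CL_def intro: continuous_map_real_mult_left)
    show "(\<lambda>x. max 0 (f x - a)) \<in> CL (Xsub X \<alpha>) (\<mu> \<alpha>)" by (rule CL_cut[OF mu_prob[OF \<alpha>] f])
  qed (use polish mu_prob mu_sets cover ne Cb_CL in auto)
  interpret B: multimarginal X "{1..n}" "Inks n k" \<mu> "\<lambda>\<alpha>. Cb (Xsub X \<alpha>)"
    by (rule multimarginal.intro)
      (use polish mu_prob mu_sets cover ne Cb_CL in \<open>auto intro!: Cb_add Cb_mult Cb_max Cb_diff Cb_const\<close>)
  \<comment> \<open>The plans do not depend on the class of potentials, so both dual problems face
    the same primal one.\<close>
  have plans: "A.plans = Marg X n k \<mu>" "B.plans = Marg X n k \<mu>"
    unfolding A.plans_def B.plans_def Marg_def by auto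
  have CLX_V: "c \<in> A.V" if "c \<in> CLX X n k \<mu>" for c
    using that unfolding CLX_def A.V_def A.pot_def A.tsum_def by auto
  show ?thesis
  proof (intro conjI ballI impI)
    fix c assume "c \<in> CLX X n k \<mu>"
    note c = CLX_V[OF this]
    show "primal X n k \<mu> c = dual X n k \<mu> (\<lambda>\<alpha>. CL (Xsub X \<alpha>) (\<mu> \<alpha>)) c"
      using A.Kantorovich_duality(1)[OF c]
      unfolding primal_def dual_def plans A.tint_def A.pot_def A.tsum_def by simp
    show "\<exists>\<pi>\<in>Marg X n k \<mu>. ereal (\<integral>x. c x \<partial>\<pi>) = primal X n k \<mu> c" if "Marg X n k \<mu> \<noteq> {}"
      using A.Kantorovich_duality(2)[OF c] that unfolding plans primal_def by simp
  next
    fix c assume "c \<in> Cb (Xsub X {1..n})"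
    then have c: "c \<in> B.V" using B.Cb_subset_V by auto
    show "primal X n k \<mu> c = dual X n k \<mu> (\<lambda>\<alpha>. Cb (Xsub X \<alpha>)) c"
      using B.Kantorovich_duality(1)[OF c]
      unfolding primal_def dual_def plans B.tint_def B.pot_def B.tsum_def by simp
    show "\<exists>\<pi>\<in>Marg X n k \<mu>. ereal (\<integral>x. c x \<partial>\<pi>) = primal X n k \<mu> c" if "Marg X n k \<mu> \<noteq> {}"
      using B.Kantorovich_duality(2)[OF c] that unfolding plans primal_def by simp
  qed
qed

end
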